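(* Let $n\ge 2$, let $\Omega\subset\mathbb{R}^n$ be a domain, let $\mu$ be a nonnegative finite Radon measure in $\Omega$, and let $x_0\in\Omega$ and $r_0>0$ satisfy $B(x_0,3r_0)\subset\Omega$. (i) If $p\in(1,n)$, then there is a subset $E\subset\mathbb{R}^n$ that is $p$-thin for the singular behavior at $x_0$ such that $$\lim_{x\to x_0,\ x\notin E}|x-x_0|^{\frac{n-p}{p-1}}\,W^{\mu}_{1,p}(x,r_0)=\frac{p-1}{n-p}\,\mu(\{x_0\})^{\frac1{p-1}}.$$ (ii) If $p=n$, then there is a subset $E\subset\mathbb{R}^n$ that is $n$-thin for the singular behavior at $x_0$ such that $$\lim_{x\to x_0,\ x\notin E}\frac{W^{\mu}_{1,n}(x,r_0)}{\log\frac1{|x-x_0|}}=\mu(\{x_0\})^{\frac1{n-1}}.$$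
   Context: Wolff potential: for a nonnegative Radon measure $\mu$ and $p\in(1,n]$, $$W^{\mu}_{1,p}(x,r)=\int_0^r\left(\frac{\mu(B(x,t))}{t^{n-p}}\right)^{\frac1{p-1}}\frac{dt}{t}.$$ $p$-capacity: for a compact subset $K$ of a domain $\Omega\subset\mathbb{R}^n$, $$cap_p(K,\Omega)=\inf\left\{\int_\Omega|\nabla u|^p\,dx:\ u\in C_0^\infty(\Omega),\ u\ge1\text{ on }K\right\},$$ and for an arbitrary subset $E\subset\Omega$, $$cap_p(E,\Omega)=\inf_{E\subset G\subset\Omega,\ G\text{ open}}\ \sup_{K\subset G,\ K\text{ compact}}cap_p(K,\Omega).$$ Thinness for the singular behavior: for $x_0\in\mathbb{R}^n$ put $$\omega_i(x_0)=\{x:2^{-i-1}\le|x-x_0|\le2^{-i}\},\qquad \Omega_i(x_0)=\{x:2^{-i-2}\le|x-x_0|\le2^{-i+1}\}$$ (capacities relative to $\Omega_i(x_0)$ are understood relative to its interior). For $p\in(1,n)$, a set $E\subset\mathbb{R}^n$ is $p$-thin for the singular behavior at $x_0$ if $$\sum_{i=1}^\infty\frac{cap_p(E\cap\omega_i(x_0),\Omega_i(x_0))}{cap_p(\partial B(x_0,2^{-i}),B(x_0,2^{-i+1}))}<+\infty.$$ A set $E$ is $n$-thin for the singular behavior at $x_0$ if $$\sum_{i=1}^\infty i^{n-1}\,cap_n(E\cap\omega_i(x_0),\Omega_i(x_0))<+\infty.$$ Limits as $x\to x_0$ are over $x\neq x_0$. *)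

theory Defs
  imports "HOL-Analysis.Analysis"
begin

text \<open>The ambient space $R^n$ is a type \<^typ>\<open>'a::euclidean_space\<close> with $n$ = \<open>DIM('a)\<close>.\<close>

definition radon_measure_on :: "'a::euclidean_space set \<Rightarrow> 'a measure \<Rightarrow> bool" where
  "radon_measure_on \<Omega> \<mu> \<longleftrightarrow>
     sets \<mu> = sets (restrict_space borel \<Omega>) \<and>
     (\<forall>K. compact K \<longrightarrow> K \<subseteq> \<Omega> \<longrightarrow> emeasure \<mu> K < \<infinity>) \<and>
     (\<forall>B\<in>sets \<mu>. emeasure \<mu> B = (INF G\<in>{G. open G \<and> B \<subseteq> G \<and> G \<subseteq> \<Omega>}. emeasure \<mu> G)) \<and>
     (\<forall>G. open G \<longrightarrow> G \<subseteq> \<Omega> \<longrightarrow>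
        emeasure \<mu> G = (SUP K\<in>{K. compact K \<and> K \<subseteq> G}. emeasure \<mu> K))"

text \<open>
  The potential is \<^typ>\<open>ennreal\<close>-valued because the integral may diverge at some points; a
  Bochner integral would silently be 0 there. Intersecting with \<^term>\<open>space \<mu>\<close> extends the
  measure by zero outside the set on which it lives. The definition is meant for finite measures
  (\<^const>\<open>measure\<close> is 0 on sets of infinite measure).
\<close>

definition wolff_potential :: "'a::euclidean_space measure \<Rightarrow> real \<Rightarrow> 'a \<Rightarrow> real \<Rightarrow> ennreal" where
  "wolff_potential \<mu> p x r =
     (\<integral>\<^sup>+t\<in>{0<..<r}. ennreal
        ((measure \<mu> (ball x t \<inter> space \<mu>) / t powr (real DIM('a) - p)) powr (1 / (p - 1)) / t)
      \<partial>lborel)"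

primrec cont_diff :: "nat \<Rightarrow> ('a::euclidean_space \<Rightarrow> real) \<Rightarrow> bool" where
  "cont_diff 0 u \<longleftrightarrow> continuous_on UNIV u"
| "cont_diff (Suc k) u \<longleftrightarrow>
     (\<forall>x. u differentiable (at x)) \<and>
     (\<forall>b\<in>Basis. cont_diff k (\<lambda>x. frechet_derivative u (at x) b))"

text \<open>
  Smooth functions with compact support in \<open>\<Omega>\<close>, identified with their extension by zero to the
  whole space.
\<close>

definition test_functions :: "'a::euclidean_space set \<Rightarrow> ('a \<Rightarrow> real) set" where
  "test_functions \<Omega> =
     {u. (\<forall>k. cont_diff k u) \<and> compact (closure {x. u x \<noteq> 0}) \<and> closure {x. u x \<noteq> 0} \<subseteq> \<Omega>}"

definition gradient :: "('a::euclidean_space \<Rightarrow> real) \<Rightarrow> 'a \<Rightarrow> 'a" where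
  "gradient u x = (\<Sum>b\<in>Basis. frechet_derivative u (at x) b *\<^sub>R b)"

definition cap_compact :: "real \<Rightarrow> 'a::euclidean_space set \<Rightarrow> 'a set \<Rightarrow> ennreal" where
  "cap_compact p K \<Omega> =
     (INF u\<in>{u \<in> test_functions \<Omega>. \<forall>x\<in>K. 1 \<le> u x}.
        \<integral>\<^sup>+x\<in>\<Omega>. ennreal (norm (gradient u x) powr p) \<partial>lborel)"

definition cap :: "real \<Rightarrow> 'a::euclidean_space set \<Rightarrow> 'a set \<Rightarrow> ennreal" where
  "cap p E \<Omega> =
     (INF G\<in>{G. open G \<and> E \<subseteq> G \<and> G \<subseteq> \<Omega>}.
        SUP K\<in>{K. compact K \<and> K \<subseteq> G}. cap_compact p K \<Omega>)"

definition shell :: "nat \<Rightarrow> 'a::euclidean_space \<Rightarrow> 'a set" where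
  "shell i x0 = {x. 2 powi (- int i - 1) \<le> norm (x - x0) \<and> norm (x - x0) \<le> 2 powi (- int i)}"

definition wide_shell :: "nat \<Rightarrow> 'a::euclidean_space \<Rightarrow> 'a set" where
  "wide_shell i x0 =
     {x. 2 powi (- int i - 2) \<le> norm (x - x0) \<and> norm (x - x0) \<le> 2 powi (- int i + 1)}"

text \<open>
  Both series run over $i \ge 1$, hence \<^term>\<open>Suc j\<close>. A series of \<^typ>\<open>ennreal\<close> terms always
  has a value, so convergence means that this value is finite.
\<close>

definition p_thin :: "real \<Rightarrow> 'a::euclidean_space set \<Rightarrow> 'a \<Rightarrow> bool" where
  "p_thin p E x0 \<longleftrightarrow>
     (\<Sum>j. let i = Suc j in
        cap p (E \<inter> shell i x0) (interior (wide_shell i x0)) /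
        cap_compact p (sphere x0 (2 powi (- int i))) (ball x0 (2 powi (- int i + 1)))) < \<infinity>"

definition n_thin :: "'a::euclidean_space set \<Rightarrow> 'a \<Rightarrow> bool" where
  "n_thin E x0 \<longleftrightarrow>
     (\<Sum>j. let i = Suc j in
        of_nat (i ^ (DIM('a) - 1)) *
        cap (real DIM('a)) (E \<inter> shell i x0) (interior (wide_shell i x0))) < \<infinity>"

end

theory Submission
  imports Defs "HOL-Computational_Algebra.Polynomial"
begin

text \<open>
Write \<open>n = DIM('a)\<close>, \<open>q = 1 / (p - 1)\<close>, \<open>\<alpha> = (n - p) / (p - 1)\<close>, \<open>\<rho> = norm (x - x0)\<close>, and let \<open>a\<close> be the
mass of \<open>{x0}\<close>. The integrand of the potential is \<open>\<mu>(B(x,t))\<^sup>q t powr (- \<alpha> - 1)\<close>.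

Radii \<open>t \<ge> \<rho> / 16\<close> are harmless. For \<open>t > \<rho>\<close> the ball \<open>B(x,t)\<close> contains \<open>x0\<close> and lies in \<open>B(x0,2t)\<close>, so
its mass is squeezed to \<open>a\<close> as \<open>t\<close> decreases to 0; for \<open>\<rho> / 16 \<le> t \<le> \<rho>\<close> it misses \<open>x0\<close> and sits in a shrinking
punctured ball, so its mass tends to 0. After multiplication by \<open>\<rho> powr \<alpha>\<close>, respectively
\<open>1 / ln (1 / \<rho>)\<close>, what survives is \<open>a powr q\<close> times the limit of the weighted integral of the kernel
\<open>t powr (- \<alpha> - 1)\<close> over \<open>t > \<rho>\<close>. Both cases of the theorem are instances of
\<open>weighted_wolff_potential_limit\<close>.

Radii \<open>t < \<rho> / 16\<close> see only the mass \<open>m\<^sub>i\<close> of an annulus around the shell of \<open>x\<close>, but nothing bounds their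
contribution pointwise. The set where it is large is discarded, and it is thin because of the weak type estimate
\<open>cap_superlevel_bound\<close>: the set where the potential of a finite measure \<open>\<nu>\<close> exceeds \<open>\<theta>\<close> has \<open>p\<close>-capacity
at most \<open>C \<nu>(UNIV) / \<theta> powr (p - 1)\<close>. The masses \<open>m\<^sub>i\<close> are summable, so some \<open>d\<^sub>i\<close> tending to
infinity keep \<open>\<Sum> m\<^sub>i d\<^sub>i\<close> finite. Discarding the superlevel sets at the heights
\<open>\<Lambda>\<^sub>i d\<^sub>i powr (- q)\<close>, with \<open>\<Lambda>\<^sub>i\<close> comparable to the reciprocal of the weight at \<open>\<rho> = 2 powi (- i)\<close>, costs
capacity \<open>C m\<^sub>i d\<^sub>i / \<Lambda>\<^sub>i powr (p - 1)\<close>, and \<open>\<Lambda>\<^sub>i powr (p - 1)\<close> is, up to a constant, what the normalisation of the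
two thinness series absorbs; off these sets the weighted contribution is \<open>O(d\<^sub>i powr (- q))\<close>. For \<open>p < n\<close>
thinness is measured relative to the capacity of a sphere, which needs a lower bound (\<open>cap_compact_sphere_lower_bound\<close>).

The weak type estimate is proved with an explicit test function. Sample the potential at the radii
\<open>r\<^sub>k = R / 2 ^ k\<close>, which gives terms \<open>b\<^sub>k\<close> with \<open>b\<^sub>k powr (p - 1) = \<nu>(B(x,r\<^sub>k)) / r\<^sub>k powr (n - p)\<close>, and stop
the sum once it exceeds \<open>\<theta>\<close>, leaving terms \<open>f\<^sub>k\<close>. Around a centre \<open>x\<close> stack radial plateaus
of height \<open>f\<^sub>k(x)\<close> and radius \<open>r\<^sub>k\<close>, each descending only between the radii \<open>r\<^sub>k / 2\<close> and \<open>r\<^sub>k\<close>, and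
take a smooth maximum over finitely many centres. Since these zones are disjoint for one centre and the gradient of
a maximum is a convex combination of gradients, at each point only one scale and one centre matter:
the gradient is at most a constant times a single \<open>f\<^sub>k(x) / r\<^sub>k\<close>, with no sum over scales. Moreover
\<open>(f\<^sub>k / r\<^sub>k) powr p \<le> f\<^sub>k \<nu>(B(x,r\<^sub>k)) / r\<^sub>k ^ n\<close>, so by Tonelli the energy is at most a constant times the \<open>\<nu>\<close>-integral
of \<open>\<Sum>\<^sub>k sup f\<^sub>k\<close>, the supremum being over centres at distance less than \<open>3 r\<^sub>k\<close>. The stopping rule bounds that sum by a multiple
of \<open>\<theta>\<close> (\<open>nearby_term_sum\<close>).
\<close>

section \<open>Calculus of smooth functions\<close>

lemma frechet_derivative_eqI: "(u has_derivative D) (at x) \<Longrightarrow> frechet_derivative u (at x) = D"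
  by (metis frechet_derivative_at)

lemma cont_diff_SucI:
  assumes "\<And>x. (u has_derivative D x) (at x)" "\<And>b. b \<in> Basis \<Longrightarrow> cont_diff k (\<lambda>x. D x b)"
  shows "cont_diff (Suc k) u"
proof -
  have "frechet_derivative u (at x) = D x" for x
    using assms(1) by (rule frechet_derivative_eqI)
  then show ?thesis
    using assms by (auto simp: differentiable_def)
qed

lemma cont_diff_has_derivative:
  assumes "cont_diff (Suc k) u"
  shows "(u has_derivative frechet_derivative u (at x)) (at x)"
  using assms by (simp add: frechet_derivative_works)

lemma cont_diff_Suc_imp: "cont_diff (Suc k) u \<Longrightarrow> cont_diff k u"
proof (induction k arbitrary: u)
  case 0
  then show ?case
    by (auto intro!: continuous_at_imp_continuous_on differentiable_imp_continuous_within)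
next
  case (Suc k)
  then show ?case by (metis cont_diff.simps(2))
qed

lemma cont_diff_const [intro]: "cont_diff k (\<lambda>x. c)"
proof (induction k arbitrary: c)
  case (Suc k)
  show ?case
    by (rule cont_diff_SucI[where D = "\<lambda>x h. 0"]) (auto intro: Suc)
qed simp

lemma cont_diff_inner [intro]: "cont_diff k (\<lambda>x. x \<bullet> v)"
proof (cases k)
  case 0
  then show ?thesis by (auto intro!: continuous_intros)
next
  case (Suc j)
  show ?thesis unfolding Suc
    by (rule cont_diff_SucI[where D = "\<lambda>x h. h \<bullet> v"]) (auto intro!: derivative_eq_intros)
qed

lemma cont_diff_add [intro]: "cont_diff k u \<Longrightarrow> cont_diff k v \<Longrightarrow> cont_diff k (\<lambda>x. u x + v x)"
proof (induction k arbitrary: u v)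
  case 0
  then show ?case by (auto intro: continuous_on_add)
next
  case (Suc k)
  show ?case
    by (rule cont_diff_SucI[where D = "\<lambda>x h. frechet_derivative u (at x) h + frechet_derivative v (at x) h"])
      (use Suc in \<open>auto intro!: has_derivative_add simp: frechet_derivative_works[symmetric]\<close>)
qed

lemma cont_diff_mult [intro]: "cont_diff k u \<Longrightarrow> cont_diff k v \<Longrightarrow> cont_diff k (\<lambda>x. u x * v x)"
proof (induction k arbitrary: u v)
  case 0
  then show ?case by (auto intro: continuous_on_mult)
next
  case (Suc k)
  show ?case
  proof (rule cont_diff_SucI[where
        D = "\<lambda>x h. u x * frechet_derivative v (at x) h + frechet_derivative u (at x) h * v x"])
    show "((\<lambda>x. u x * v x) has_derivative
        (\<lambda>h. u x * frechet_derivative v (at x) h + frechet_derivative u (at x) h * v x)) (at x)" for x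
      using Suc.prems by (intro has_derivative_mult cont_diff_has_derivative)
    show "cont_diff k (\<lambda>x. u x * frechet_derivative v (at x) b + frechet_derivative u (at x) b * v x)"
      if "b \<in> Basis" for b
      using Suc.prems(1,2)[THEN cont_diff_Suc_imp] Suc.prems that
      by (intro cont_diff_add Suc.IH) auto
  qed
qed

lemma cont_diff_sum [intro]:
  "(\<And>i. i \<in> I \<Longrightarrow> cont_diff k (u i)) \<Longrightarrow> cont_diff k (\<lambda>x. \<Sum>i\<in>I. u i x)"
  by (induction I rule: infinite_finite_induct) auto

lemma cont_diff_diff [intro]:
  assumes "cont_diff k u" "cont_diff k v"
  shows "cont_diff k (\<lambda>x. u x - v x)"
  using cont_diff_add[OF assms(1) cont_diff_mult[OF cont_diff_const[where c = "-1"] assms(2)]] by simp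

text \<open>
The derivatives are carried along as a sequence, which makes sense on any set \<open>S\<close>. This lets \<^const>\<open>ln\<close> and
\<^const>\<open>inverse\<close> be composed with positive functions, although they are not smooth on the whole line.
\<close>

definition smooth_on :: "real set \<Rightarrow> (real \<Rightarrow> real) \<Rightarrow> bool" where
  "smooth_on S F \<longleftrightarrow>
     (\<exists>D. D 0 = F \<and> (\<forall>m. \<forall>x\<in>S. (D m has_real_derivative D (Suc m) x) (at x)))"

text \<open>
By the chain rule a partial derivative of \<open>D m \<circ> u\<close> is \<open>D (Suc m) \<circ> u\<close> times one of \<open>u\<close>, so the induction on the order
must treat all members of the derivative sequence at once.
\<close>

lemma cont_diff_compose:
  fixes u :: "'a::euclidean_space \<Rightarrow> real"
  assumes "smooth_on S F" "\<And>x. u x \<in> S" "cont_diff k u"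
  shows "cont_diff k (\<lambda>x. F (u x))"
proof -
  obtain D where D: "D 0 = F" "\<And>m x. x \<in> S \<Longrightarrow> (D m has_real_derivative D (Suc m) x) (at x)"
    using assms(1) unfolding smooth_on_def by blast
  have "cont_diff k (\<lambda>x. D m (u x))" for m
    using assms(3)
  proof (induction k arbitrary: m)
    case 0
    have "isCont (\<lambda>x. D m (u x)) x" for x
    proof (rule isCont_o2[where f = u and g = "D m"])
      show "isCont u x" using 0 by (simp add: continuous_on_eq_continuous_at)
      show "isCont (D m) (u x)" using D(2)[OF assms(2)] by (rule DERIV_isCont)
    qed
    then have "continuous_on UNIV (\<lambda>x. D m (u x))" by (simp add: continuous_on_eq_continuous_at)
    then show ?case by simp
  next
    case (Suc k)
    show ?case
    proof (rule cont_diff_SucI[where D = "\<lambda>x h. D (Suc m) (u x) * frechet_derivative u (at x) h"])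
      show "((\<lambda>x. D m (u x)) has_derivative (\<lambda>h. D (Suc m) (u x) * frechet_derivative u (at x) h)) (at x)" for x
        using has_derivative_compose[OF cont_diff_has_derivative[OF Suc.prems],
            where g = "D m" and g' = "(*) (D (Suc m) (u x))"] D(2)[OF assms(2)]
        by (simp add: has_field_derivative_def)
      show "cont_diff k (\<lambda>x. D (Suc m) (u x) * frechet_derivative u (at x) b)" if "b \<in> Basis" for b
        using cont_diff_Suc_imp[OF Suc.prems] Suc.prems that by (intro cont_diff_mult Suc.IH) auto
    qed
  qed
  from this[of 0] show ?thesis by (simp add: D)
qed

lemma smooth_on_exp: "smooth_on UNIV (\<lambda>x. exp (c * x))"
  unfolding smooth_on_def
  by (rule exI[where x = "\<lambda>m x. c ^ m * exp (c * x)"]) (auto intro!: derivative_eq_intros)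

lemma smooth_on_inverse: "smooth_on {0<..} inverse"
  unfolding smooth_on_def
proof (rule exI[where x = "\<lambda>m x. (- 1) ^ m * fact m * inverse x ^ Suc m"], intro conjI allI ballI)
  fix m and x :: real assume x: "x \<in> {0<..}"
  have "((\<lambda>x. inverse x ^ Suc m) has_real_derivative
      real (Suc m) * inverse x ^ m * - (inverse x ^ Suc (Suc 0))) (at x)"
    using x DERIV_power[OF DERIV_inverse[of x UNIV], of "Suc m"] by (auto simp: algebra_simps)
  from DERIV_cmult[OF this, of "(- 1) ^ m * fact m"]
  show "((\<lambda>x. (- 1) ^ m * fact m * inverse x ^ Suc m) has_real_derivative
      (- 1) ^ Suc m * fact (Suc m) * inverse x ^ Suc (Suc m)) (at x)"
    by (simp add: algebra_simps)
qed simp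

lemma smooth_on_ln: "smooth_on {0<..} ln"
proof -
  obtain D where D: "D 0 = inverse" "\<And>m x. x \<in> {0<..} \<Longrightarrow> (D m has_real_derivative D (Suc m) x) (at x)"
    using smooth_on_inverse unfolding smooth_on_def by blast
  show ?thesis
    unfolding smooth_on_def
  proof (rule exI[where x = "case_nat ln D"], intro conjI allI ballI)
    fix m and x :: real assume "x \<in> {0<..}"
    then show "(case_nat ln D m has_real_derivative case_nat ln D (Suc m) x) (at x)"
      by (cases m) (auto simp: D intro!: DERIV_ln)
  qed simp
qed

section \<open>A smooth cutoff function\<close>

text \<open>
The polynomials with \<open>d\<^sup>m/dt\<^sup>m exp (- 1/t) = P\<^sub>m(1/t) exp (- 1/t)\<close>.
\<close>

primrec flat_poly :: "nat \<Rightarrow> real poly" where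
  "flat_poly 0 = 1"
| "flat_poly (Suc m) = [:0, 0, 1:] * (flat_poly m - pderiv (flat_poly m))"

definition flat_deriv :: "nat \<Rightarrow> real \<Rightarrow> real" where
  "flat_deriv m t = (if t > 0 then poly (flat_poly m) (1 / t) * exp (- (1 / t)) else 0)"

lemma poly_times_exp_tendsto_0: "((\<lambda>s::real. poly P s * exp (- s)) \<longlongrightarrow> 0) at_top"
proof -
  have "((\<lambda>s. \<Sum>i\<le>degree P. coeff P i * (s ^ i / exp s)) \<longlongrightarrow> (\<Sum>i\<le>degree P. coeff P i * 0)) at_top"
    by (intro tendsto_intros tendsto_power_div_exp_0)
  moreover have "(\<Sum>i\<le>degree P. coeff P i * (s ^ i / exp s)) = poly P s * exp (- s)" for s
    by (simp add: poly_altdef sum_distrib_right exp_minus field_simps sum_divide_distrib)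
  ultimately show ?thesis by simp
qed

text \<open>
Only the point 0 needs an argument: there the difference quotient from the right is a polynomial in \<open>1/t\<close> times \<open>exp (- 1/t)\<close>.
\<close>

lemma flat_deriv_has_derivative:
  "(flat_deriv m has_real_derivative flat_deriv (Suc m) t) (at t)"
proof -
  consider "t > 0" | "t < 0" | "t = 0" by linarith
  then show ?thesis
  proof cases
    case 1
    let ?P = "flat_poly m"
    have "((\<lambda>t. poly ?P (1 / t) * exp (- (1 / t))) has_real_derivative
        (poly (pderiv ?P) (1 / t) * (- 1 / t\<^sup>2)) * exp (- (1 / t))
        + poly ?P (1 / t) * (exp (- (1 / t)) * (1 / t\<^sup>2))) (at t)"
      using 1 by (auto intro!: derivative_eq_intros DERIV_chain2[OF poly_DERIV]
          simp: power2_eq_square)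
    also have "(poly (pderiv ?P) (1 / t) * (- 1 / t\<^sup>2)) * exp (- (1 / t))
        + poly ?P (1 / t) * (exp (- (1 / t)) * (1 / t\<^sup>2)) = flat_deriv (Suc m) t"
      using 1 by (simp add: flat_deriv_def field_simps power2_eq_square)
    finally show ?thesis
      by (rule has_field_derivative_transform_within_open[where S = "{0<..}"])
        (use 1 in \<open>auto simp: flat_deriv_def\<close>)
  next
    case 2
    have "((\<lambda>t. 0) has_real_derivative flat_deriv (Suc m) t) (at t)"
      using 2 by (simp add: flat_deriv_def)
    then show ?thesis
      by (rule has_field_derivative_transform_within_open[where S = "{..<0}"])
        (use 2 in \<open>auto simp: flat_deriv_def\<close>)
  next
    case 3
    have "((\<lambda>s. poly ([:0, 1:] * flat_poly m) s * exp (- s)) \<longlongrightarrow> 0) at_top"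
      by (rule poly_times_exp_tendsto_0)
    then have "((\<lambda>t. poly ([:0, 1:] * flat_poly m) (inverse t) * exp (- inverse t)) \<longlongrightarrow> 0) (at_right 0)"
      by (rule filterlim_compose) (rule filterlim_inverse_at_top_right)
    then have "((\<lambda>t. flat_deriv m t / t) \<longlongrightarrow> 0) (at_right 0)"
      by (rule Lim_transform_eventually)
        (auto intro!: eventually_at_rightI[of 0 1] simp: flat_deriv_def field_simps)
    moreover have "((\<lambda>t. flat_deriv m t / t) \<longlongrightarrow> 0) (at_left 0)"
      by (rule Lim_transform_eventually[OF tendsto_const])
        (auto intro!: eventually_at_leftI[of "-1" 0] simp: flat_deriv_def)
    ultimately have "((\<lambda>t. flat_deriv m t / t) \<longlongrightarrow> 0) (at 0)"
      by (simp add: filterlim_at_split)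
    then show ?thesis
      using 3 by (simp add: has_field_derivative_iff flat_deriv_def)
  qed
qed

lemma smooth_on_flat: "smooth_on UNIV (flat_deriv 0)"
  unfolding smooth_on_def using flat_deriv_has_derivative by blast

lemma cont_diff_imp_smooth_on:
  fixes F :: "real \<Rightarrow> real"
  assumes "\<And>k. cont_diff k F"
  shows "smooth_on UNIV F"
proof -
  define D where "D m = ((\<lambda>F x. frechet_derivative F (at x) 1) ^^ m) F" for m
  have D: "cont_diff k (D m)" for k m
  proof (induction m arbitrary: k)
    case 0
    then show ?case using assms by (simp add: D_def)
  next
    case (Suc m)
    have "D (Suc m) = (\<lambda>x. frechet_derivative (D m) (at x) 1)" by (simp add: D_def)
    then show ?case using Suc[of "Suc k"] by simp
  qed
  have "(D m has_real_derivative D (Suc m) x) (at x)" for m x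
  proof -
    have "(D m has_derivative frechet_derivative (D m) (at x)) (at x)"
      using D[of "Suc 0"] by (rule cont_diff_has_derivative)
    moreover from this have "frechet_derivative (D m) (at x) h = frechet_derivative (D m) (at x) 1 * h" for h
      using linear_cmul[OF has_derivative_linear, of "D m" _ "at x" h 1] by (metis mult.commute mult.right_neutral real_scaleR_def)
    then have "frechet_derivative (D m) (at x) = (*) (frechet_derivative (D m) (at x) 1)" by (rule ext)
    ultimately show ?thesis
      by (simp add: has_field_derivative_def D_def)
  qed
  then show ?thesis unfolding smooth_on_def by (intro exI[of _ D]) (auto simp: D_def)
qed

text \<open>
With the flat function \<open>h\<close>, the quotient \<open>h (1 - s) / (h (1 - s) + h (s - 1/4))\<close> does the job. The derivative vanishes
at 1/4 and 1 too, because it is continuous; hence plateaus at consecutive dyadic scales, whose squared radii differ by the factor 4,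
never descend at the same point.
\<close>

lemma smooth_cutoff_exists:
  obtains \<phi> \<phi>' :: "real \<Rightarrow> real" and C where
    "smooth_on UNIV \<phi>" "\<And>s. (\<phi> has_real_derivative \<phi>' s) (at s)"
    "\<And>s. 0 \<le> \<phi> s" "\<And>s. s \<le> 1/4 \<Longrightarrow> \<phi> s = 1" "\<And>s. s \<ge> 1 \<Longrightarrow> \<phi> s = 0"
    "\<And>s. \<bar>\<phi>' s\<bar> \<le> C" "C > 0" "\<And>s. s \<le> 1/4 \<or> s \<ge> 1 \<Longrightarrow> \<phi>' s = 0"
proof -
  let ?h = "flat_deriv 0"
  define q where "q s = ?h (1 - s) + ?h (s - 1/4)" for s
  define \<phi> where "\<phi> s = ?h (1 - s) * inverse (q s)" for s
  have h: "0 \<le> ?h t" "t > 0 \<Longrightarrow> 0 < ?h t" "t \<le> 0 \<Longrightarrow> ?h t = 0" for t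
    by (auto simp: flat_deriv_def)
  have q: "q s > 0" for s
    unfolding q_def using h(1)[of "1 - s"] h(1)[of "s - 1/4"] h(2)[of "1 - s"] h(2)[of "s - 1/4"]
    by (cases "s < 1") auto
  have id: "cont_diff k (\<lambda>s::real. s)" for k
    using cont_diff_inner[of k "1::real"] by simp
  have "cont_diff k (\<lambda>s. ?h (1 - s))" "cont_diff k (\<lambda>s. ?h (s - 1/4))" for k
    by (auto intro!: cont_diff_compose[OF smooth_on_flat] id)
  then have "cont_diff k \<phi>" for k
    unfolding \<phi>_def using q
    by (intro cont_diff_mult cont_diff_compose[OF smooth_on_inverse]) (auto simp: q_def)
  then have sm: "smooth_on UNIV \<phi>" by (rule cont_diff_imp_smooth_on)
  then obtain D where D: "D 0 = \<phi>" "\<And>m s. (D m has_real_derivative D (Suc m) s) (at s)"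
    unfolding smooth_on_def by auto
  have one: "\<phi> s = 1" if "s \<le> 1/4" for s
    using that q[of s] h(3)[of "s - 1/4"] by (simp add: \<phi>_def q_def)
  have zero: "\<phi> s = 0" if "s \<ge> 1" for s
    using that h(3)[of "1 - s"] by (simp add: \<phi>_def)
  have cont: "isCont (D 1) s" for s using D(2)[of 1] by (auto intro: DERIV_isCont)
  have deriv: "(\<phi> has_real_derivative D 1 s) (at s)" for s using D(2)[of 0 s] by (simp add: D)
  have "D 1 s = 0" if "s < 1/4 \<or> s > 1" for s
  proof -
    have "(\<phi> has_real_derivative 0) (at s)"
    proof (cases "s < 1/4")
      case True
      show ?thesis
        by (rule has_field_derivative_transform_within_open[where S = "{..<1/4}" and f = "\<lambda>_. 1"])
          (use True one in auto)
    next
      case False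
      show ?thesis
        by (rule has_field_derivative_transform_within_open[where S = "{1<..}" and f = "\<lambda>_. 0"])
          (use that False zero in auto)
    qed
    then show ?thesis using deriv DERIV_unique by blast
  qed
  then have int: "{..<1/4} \<union> {1<..} \<subseteq> {s. D 1 s = 0}" by auto
  have "closed {s. D 1 s = 0}"
    using cont by (intro closed_Collect_eq) (auto intro: continuous_at_imp_continuous_on)
  then have "closure ({..<1/4} \<union> {1<..}) \<subseteq> {s. D 1 s = 0}"
    using int by (rule closure_minimal[rotated])
  then have D0: "D 1 s = 0" if "s \<le> 1/4 \<or> s \<ge> 1" for s
    using that by (auto simp: closure_Un)
  have "continuous_on {1/4..1} (D 1)" using cont by (auto intro: continuous_at_imp_continuous_on)
  then have "bounded (D 1 ` {1/4..1})"
    by (intro compact_imp_bounded compact_continuous_image) auto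
  then obtain C where C: "C > 0" "\<And>s. s \<in> {1/4..1} \<Longrightarrow> \<bar>D 1 s\<bar> \<le> C"
    unfolding bounded_pos by auto
  show thesis
  proof (rule that[OF sm deriv])
    show "0 \<le> \<phi> s" for s using h(1) q[of s] by (simp add: \<phi>_def)
    show "\<bar>D 1 s\<bar> \<le> C" for s
    proof (cases "s \<in> {1/4..1}")
      case False
      then have "D 1 s = 0" by (intro D0) auto
      then show ?thesis using C(1) by simp
    qed (rule C(2))
  qed (fact one zero C(1) D0)+
qed

section \<open>A smooth maximum\<close>

lemma gradient_eqI:
  assumes "(u has_derivative (\<lambda>h. h \<bullet> v)) (at x)"
  shows "gradient u x = v"
  unfolding gradient_def frechet_derivative_eqI[OF assms]
  by (simp add: inner_commute[of _ v] euclidean_representation)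

text \<open>
The function \<open>u = (1/q) ln ((1 + \<Sum> exp (q \<psi>\<^sub>x)) / (1 + card X))\<close> for large \<open>q\<close>. Its gradient is a combination of the gradients of
the \<open>\<psi>\<^sub>x\<close> with nonnegative weights of sum at most 1, hence no longer than the longest of them. The summand 1 stands for the zero
function; it covers empty \<open>X\<close>, and the normalisation makes \<open>u\<close> vanish where all \<open>\<psi>\<^sub>x\<close> do.
\<close>

lemma smooth_maximum:
  fixes \<psi> :: "'b \<Rightarrow> 'a::euclidean_space \<Rightarrow> real"
  assumes fin: "finite X" and smooth: "\<And>k x. x \<in> X \<Longrightarrow> cont_diff k (\<psi> x)"
    and deriv: "\<And>x z. x \<in> X \<Longrightarrow> (\<psi> x has_derivative (\<lambda>h. h \<bullet> G x z)) (at z)"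
    and \<epsilon>: "\<epsilon> > 0"
  obtains u where "\<And>k. cont_diff k u" "\<And>x z. x \<in> X \<Longrightarrow> \<psi> x z - \<epsilon> \<le> u z"
    "\<And>z. u z \<noteq> 0 \<Longrightarrow> \<exists>x\<in>X. \<psi> x z \<noteq> 0"
    "\<And>z. gradient u z = 0 \<or> (\<exists>x\<in>X. norm (gradient u z) \<le> norm (G x z))"
proof -
  define q where "q = (ln (1 + card X) + 1) / \<epsilon>"
  have "ln (1 + real (card X)) \<ge> 0" by (intro ln_ge_zero) auto
  then have ln_pos: "0 < 1 + ln (1 + real (card X))" by linarith
  then have q: "q > 0" using \<epsilon> by (simp add: q_def add.commute)
  have "ln (1 + real (card X)) / (1 + ln (1 + real (card X))) \<le> 1" using ln_pos by simp
  then have q2: "ln (1 + real (card X)) / q \<le> \<epsilon>"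
    using mult_left_mono[of "ln (1 + real (card X)) / (1 + ln (1 + real (card X)))" 1 \<epsilon>] \<epsilon>
    by (simp add: q_def add.commute mult.commute)
  define s where "s z = 1 + (\<Sum>x\<in>X. exp (q * \<psi> x z))" for z
  have s: "s z \<ge> 1" for z by (auto simp: s_def intro!: sum_nonneg)
  define u where "u z = (ln (s z) - ln (1 + card X)) * (1 / q)" for z
  define w where "w x z = exp (q * \<psi> x z) / s z" for x z
  have w: "w x z \<ge> 0" "(\<Sum>x\<in>X. w x z) \<le> 1" for x z
    using s[of z] by (auto simp: w_def s_def simp flip: sum_divide_distrib)
  have u': "(u has_derivative (\<lambda>h. h \<bullet> (\<Sum>x\<in>X. w x z *\<^sub>R G x z))) (at z)" for z
  proof -
    have "(s has_derivative (\<lambda>h. 0 + (\<Sum>x\<in>X. q * (h \<bullet> G x z) * exp (q * \<psi> x z)))) (at z)"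
      unfolding s_def
      by (intro has_derivative_add has_derivative_const has_derivative_sum has_derivative_exp
          has_derivative_mult_right deriv)
    then have "((\<lambda>z. ln (s z)) has_derivative
        (\<lambda>h. (0 + (\<Sum>x\<in>X. q * (h \<bullet> G x z) * exp (q * \<psi> x z))) * inverse (s z))) (at z)"
      using s[of z] by (intro has_derivative_ln) auto
    then have "(u has_derivative (\<lambda>h. ((0 + (\<Sum>x\<in>X. q * (h \<bullet> G x z) * exp (q * \<psi> x z))) * inverse (s z) - 0) * (1 / q))) (at z)"
      unfolding u_def by (intro has_derivative_mult_left has_derivative_diff has_derivative_const)
    also have "(\<lambda>h. ((0 + (\<Sum>x\<in>X. q * (h \<bullet> G x z) * exp (q * \<psi> x z))) * inverse (s z) - 0) * (1 / q))
      = (\<lambda>h. h \<bullet> (\<Sum>x\<in>X. w x z *\<^sub>R G x z))"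
      using q by (auto simp: fun_eq_iff inner_sum_right w_def sum_distrib_right field_simps sum_divide_distrib intro!: sum.cong)
    finally show ?thesis .
  qed
  show thesis
  proof (rule that)
    show "cont_diff k u" for k
    proof -
      have "cont_diff k s" unfolding s_def
        by (intro cont_diff_add cont_diff_const cont_diff_sum cont_diff_compose[OF smooth_on_exp] smooth) auto
      moreover have "s z \<in> {0<..}" for z using s[of z] by auto
      ultimately have "cont_diff k (\<lambda>z. ln (s z))"
        by (intro cont_diff_compose[OF smooth_on_ln])
      then show ?thesis unfolding u_def
        by (intro cont_diff_mult cont_diff_diff cont_diff_const)
    qed
    show "\<psi> x z - \<epsilon> \<le> u z" if "x \<in> X" for x z
    proof -
      have "exp (q * \<psi> x z) \<le> (\<Sum>x\<in>X. exp (q * \<psi> x z))"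
        using fin that by (intro member_le_sum) auto
      then have "exp (q * \<psi> x z) \<le> s z" by (simp add: s_def)
      then have "q * \<psi> x z \<le> ln (s z)" using s[of z] by (simp add: ln_ge_iff)
      then have "\<psi> x z \<le> ln (s z) / q" using q by (simp add: field_simps)
      then show ?thesis using q2 by (simp add: u_def algebra_simps diff_divide_distrib)
    qed
    show "\<exists>x\<in>X. \<psi> x z \<noteq> 0" if "u z \<noteq> 0" for z
    proof (rule ccontr)
      assume "\<not> ?thesis"
      then have "s z = 1 + card X" by (simp add: s_def)
      then show False using that by (simp add: u_def)
    qed
    show "gradient u z = 0 \<or> (\<exists>x\<in>X. norm (gradient u z) \<le> norm (G x z))" for z
    proof (cases "X = {}")
      case True
      then show ?thesis using gradient_eqI[OF u'[of z]] by simp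
    next
      case False
      define m where "m = Max ((\<lambda>x. norm (G x z)) ` X)"
      have m: "norm (G x z) \<le> m" if "x \<in> X" for x
        using that fin by (auto simp: m_def)
      have "m \<in> (\<lambda>x. norm (G x z)) ` X" unfolding m_def using fin False by (intro Max_in) auto
      then obtain x where x: "x \<in> X" "m = norm (G x z)" by auto
      have "norm (\<Sum>x\<in>X. w x z *\<^sub>R G x z) \<le> (\<Sum>x\<in>X. w x z * m)"
        using w(1) m by (intro sum_norm_le) (auto intro!: mult_left_mono)
      also have "\<dots> = (\<Sum>x\<in>X. w x z) * m" by (simp add: sum_distrib_right)
      also have "\<dots> \<le> 1 * m" using w(2) x by (intro mult_right_mono) auto
      finally show ?thesis using gradient_eqI[OF u'[of z]] x by auto
    qed
  qed
qed

section \<open>Dyadic Wolff sums stopped at a given height\<close>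

definition dyadic_term :: "'a::euclidean_space measure \<Rightarrow> real \<Rightarrow> real \<Rightarrow> nat \<Rightarrow> 'a \<Rightarrow> real" where
  "dyadic_term \<nu> p R k x =
     (measure \<nu> (ball x (R / 2 ^ k)) / (R / 2 ^ k) powr (real DIM('a) - p)) powr (1 / (p - 1))"

definition dyadic_potential :: "'a::euclidean_space measure \<Rightarrow> real \<Rightarrow> real \<Rightarrow> nat \<Rightarrow> 'a \<Rightarrow> real" where
  "dyadic_potential \<nu> p R N x = (\<Sum>k<N. dyadic_term \<nu> p R k x)"

text \<open>
A term counts as long as the sum of its predecessors has not passed \<open>\<theta>\<close>. Capping the last one at \<open>\<theta>\<close> keeps the stopped sum
of order \<open>\<theta>\<close> without losing any point where the full sum exceeds \<open>\<theta>\<close>.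
\<close>

definition stopped_term ::
    "'a::euclidean_space measure \<Rightarrow> real \<Rightarrow> real \<Rightarrow> real \<Rightarrow> nat \<Rightarrow> 'a \<Rightarrow> real" where
  "stopped_term \<nu> p R \<theta> k x =
     (if dyadic_potential \<nu> p R k x \<le> \<theta> then min (dyadic_term \<nu> p R k x) \<theta> else 0)"

lemma dyadic_term_nonneg: "0 \<le> dyadic_term \<nu> p R k x"
  by (simp add: dyadic_term_def)

lemma dyadic_potential_mono: "M \<le> N \<Longrightarrow> dyadic_potential \<nu> p R M x \<le> dyadic_potential \<nu> p R N x"
  unfolding dyadic_potential_def by (rule sum_mono2) (auto simp: dyadic_term_nonneg)

lemma stopped_sum:
  assumes "0 \<le> \<theta>"
  shows "min (dyadic_potential \<nu> p R N x) \<theta> \<le> (\<Sum>k<N. stopped_term \<nu> p R \<theta> k x)"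
proof (induction N)
  case 0
  then show ?case using assms by (simp add: dyadic_potential_def)
next
  case (Suc N)
  have "dyadic_potential \<nu> p R (Suc N) x = dyadic_potential \<nu> p R N x + dyadic_term \<nu> p R N x"
    by (simp add: dyadic_potential_def)
  moreover have "(\<Sum>k<N. stopped_term \<nu> p R \<theta> k x) \<ge> 0"
    using assms dyadic_term_nonneg[of \<nu> p R _ x] by (intro sum_nonneg) (simp add: stopped_term_def)
  moreover have "stopped_term \<nu> p R \<theta> N x =
      (if dyadic_potential \<nu> p R N x \<le> \<theta> then min (dyadic_term \<nu> p R N x) \<theta> else 0)"
    by (simp add: stopped_term_def)
  ultimately show ?case
    using Suc assms dyadic_term_nonneg[of \<nu> p R N x] by auto
qed

lemma shifted_sum_le:
  fixes b :: "nat \<Rightarrow> real"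
  shows "(\<Sum>k<M. if k < 3 then l else c * b (k - 3)) = l * real (min M 3) + c * (\<Sum>k<M - 3. b k)"
proof (induction M)
  case (Suc M)
  show ?case
  proof (cases "M < 3")
    case True
    then have "Suc M - 3 = 0" "M - 3 = 0" "min (Suc M) 3 = Suc (min M 3)" by auto
    then show ?thesis using Suc True by (simp add: algebra_simps)
  next
    case False
    then have "Suc M - 3 = Suc (M - 3)" "min (Suc M) 3 = 3" "min M 3 = 3" by auto
    then show ?thesis using Suc False by (simp add: algebra_simps)
  qed
qed simp

context
  fixes \<nu> :: "'a::euclidean_space measure" and p R \<theta> :: real
  assumes sets_\<nu>: "sets \<nu> = sets borel" and finite_\<nu>: "finite_measure \<nu>"
    and p: "1 < p" and R: "0 < R" and \<theta>: "0 < \<theta>"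
begin

interpretation finite_measure \<nu> by (rule finite_\<nu>)

lemma stopped_term_bounds:
  "0 \<le> stopped_term \<nu> p R \<theta> k x" "stopped_term \<nu> p R \<theta> k x \<le> dyadic_term \<nu> p R k x"
  "stopped_term \<nu> p R \<theta> k x \<le> \<theta>"
  using \<theta> dyadic_term_nonneg[of \<nu> p R k x] by (auto simp: stopped_term_def)

lemma measure_ball_mono: "ball x r \<subseteq> ball y s \<Longrightarrow> measure \<nu> (ball x r) \<le> measure \<nu> (ball y s)"
  by (intro finite_measure_mono) (simp_all add: sets_\<nu>)

text \<open>
Since \<open>B(x, r\<^sub>j)\<close> lies in \<open>B(x', 8 r\<^sub>j)\<close>, enlarging the radius by three dyadic steps pays for moving the centre.
\<close>

lemma dyadic_term_shift:
  assumes "dist y x < 3 * (R / 2 ^ j)" "dist y x' < 3 * (R / 2 ^ k)" "3 \<le> j" "j \<le> k"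
  shows "dyadic_term \<nu> p R j x
    \<le> 8 powr ((real DIM('a) - p) / (p - 1)) * dyadic_term \<nu> p R (j - 3) x'"
proof -
  let ?r = "R / 2 ^ j" and ?d = "real DIM('a) - p"
  have r: "R / 2 ^ (j - 3) = 8 * ?r"
  proof -
    have "(2::real) ^ j = 2 ^ (j - 3) * 2 ^ 3" using assms(3) by (subst power_add[symmetric]) simp
    then show ?thesis by simp
  qed
  have rk: "R / 2 ^ k \<le> ?r" using assms(4) R by (intro divide_left_mono) auto
  have rpos: "?r > 0" using R by simp
  have sub: "ball x ?r \<subseteq> ball x' (8 * ?r)"
  proof
    fix z assume "z \<in> ball x ?r"
    then have "dist x z < ?r" by simp
    moreover have "dist x' z \<le> dist y x' + dist y x + dist x z"
      by (metis add.commute add_left_mono dist_commute dist_triangle dist_triangle2 order_trans)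
    ultimately show "z \<in> ball x' (8 * ?r)" using assms rk rpos by simp
  qed
  have "dyadic_term \<nu> p R j x \<le> (measure \<nu> (ball x' (8 * ?r)) / ?r powr ?d) powr (1 / (p - 1))"
    unfolding dyadic_term_def
    using p by (intro powr_mono2 divide_right_mono measure_ball_mono[OF sub]) auto
  also have "\<dots> = (8 powr ?d * (measure \<nu> (ball x' (8 * ?r)) / (8 * ?r) powr ?d)) powr (1 / (p - 1))"
  proof -
    have "(8 * ?r) powr ?d = 8 powr ?d * ?r powr ?d" by (rule powr_mult)
    moreover have "m / a = c * (m / (c * a))" if "c \<noteq> 0" for m a c :: real using that by simp
    ultimately show ?thesis by (metis powr_eq_0_iff zero_neq_numeral)
  qed
  also have "\<dots> = 8 powr (?d / (p - 1)) * dyadic_term \<nu> p R (j - 3) x'"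
    unfolding dyadic_term_def r by (subst powr_mult) (auto simp: powr_powr)
  finally show ?thesis .
qed

text \<open>
The largest stopped term at scale \<open>k\<close> among the centres in \<open>X\<close> that are close to \<open>y\<close>.
\<close>

definition nearby_term :: "'a set \<Rightarrow> nat \<Rightarrow> 'a \<Rightarrow> ennreal" where
  "nearby_term X k y = (SUP x\<in>X. ennreal (stopped_term \<nu> p R \<theta> k x) * indicator (ball x (3 * (R / 2 ^ k))) y)"

text \<open>
The centre that realises the supremum changes with the scale, so the stopping rule does not apply directly. Let \<open>N\<close> be
the last scale with a nonzero term, realised by a centre \<open>x'\<close>. The sum at \<open>x'\<close> was not stopped before \<open>N\<close>, and by
\<open>dyadic_term_shift\<close> every earlier nearby term is bounded by a term of that one sum, three scales up; the three coarsest
terms are at most \<open>\<theta>\<close> each.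
\<close>

lemma nearby_term_sum:
  "(\<Sum>k<N. nearby_term X k y) \<le> ennreal ((3 + 8 powr ((real DIM('a) - p) / (p - 1))) * \<theta>)"
proof (induction N)
  case (Suc N)
  let ?c = "8 powr ((real DIM('a) - p) / (p - 1))"
  show ?case
  proof (cases "nearby_term X N y = 0")
    case True
    then show ?thesis using Suc by simp
  next
    case False
    then obtain x' where x': "x' \<in> X" "dist y x' < 3 * (R / 2 ^ N)" "stopped_term \<nu> p R \<theta> N x' > 0"
    proof -
      have "\<exists>x\<in>X. ennreal (stopped_term \<nu> p R \<theta> N x) * indicator (ball x (3 * (R / 2 ^ N))) y \<noteq> 0"
      proof (rule ccontr)
        assume "\<not> ?thesis"
        then have "nearby_term X N y \<le> 0" unfolding nearby_term_def by (intro SUP_least) simp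
        then show False using False by simp
      qed
      then show ?thesis using that
        by (auto simp: indicator_def dist_commute ennreal_eq_0_iff not_le split: if_splits)
    qed
    have pot: "dyadic_potential \<nu> p R N x' \<le> \<theta>"
      using x'(3) by (auto simp: stopped_term_def split: if_splits)
    let ?g = "\<lambda>k. if k < 3 then \<theta> else ?c * dyadic_term \<nu> p R (k - 3) x'"
    have "nearby_term X k y \<le> ennreal (?g k)" if "k < Suc N" for k
      unfolding nearby_term_def
    proof (rule SUP_least)
      fix x assume "x \<in> X"
      show "ennreal (stopped_term \<nu> p R \<theta> k x) * indicator (ball x (3 * (R / 2 ^ k))) y \<le> ennreal (?g k)"
      proof (cases "dist y x < 3 * (R / 2 ^ k)")
        case True
        have "stopped_term \<nu> p R \<theta> k x \<le> ?g k"
          using dyadic_term_shift[OF True x'(2)] stopped_term_bounds(2,3)[of k x] that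
          by (auto intro: order_trans)
        then show ?thesis using True by (simp add: dist_commute ennreal_leI)
      qed (simp add: dist_commute)
    qed
    then have "(\<Sum>k<Suc N. nearby_term X k y) \<le> (\<Sum>k<Suc N. ennreal (?g k))"
      by (intro sum_mono) auto
    also have "\<dots> = ennreal (\<Sum>k<Suc N. ?g k)"
      using \<theta> by (intro sum_ennreal) (auto simp: dyadic_term_nonneg)
    also have "(\<Sum>k<Suc N. ?g k) = \<theta> * real (min (Suc N) 3) + ?c * dyadic_potential \<nu> p R (Suc N - 3) x'"
      unfolding dyadic_potential_def by (rule shifted_sum_le)
    also have "ennreal \<dots> \<le> ennreal (\<theta> * 3 + ?c * \<theta>)"
    proof (intro ennreal_leI add_mono mult_left_mono)
      show "dyadic_potential \<nu> p R (Suc N - 3) x' \<le> \<theta>"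
        using dyadic_potential_mono[of "Suc N - 3" N \<nu> p R x'] pot by simp
    qed (use \<theta> in auto)
    finally show ?thesis by (simp add: algebra_simps)
  qed
qed simp

lemma nearby_term_measurable [measurable]: "countable X \<Longrightarrow> nearby_term X k \<in> borel_measurable borel"
proof -
  assume [simp]: "countable X"
  have [measurable]: "ball x (3 * (R / 2 ^ k)) \<in> sets borel" for x :: 'a by simp
  show "nearby_term X k \<in> borel_measurable borel"
    unfolding nearby_term_def[abs_def] by measurable
qed

section \<open>The capacity of superlevel sets\<close>

text \<open>
A majorant for the \<open>p\<close>-th power of the gradient of the test function, up to a constant factor.
\<close>

definition energy_density :: "'a set \<Rightarrow> nat \<Rightarrow> 'a \<Rightarrow> ennreal" where
  "energy_density X N z =
     (\<Sum>k<N. ennreal (1 / (R / 2 ^ k) ^ DIM('a)) *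
       (\<integral>\<^sup>+y. nearby_term X k y * indicator (ball z (2 * (R / 2 ^ k))) y \<partial>\<nu>))"

text \<open>
Of the \<open>p\<close> factors \<open>f\<^sub>k\<close>, \<open>p - 1\<close> are traded for mass by \<open>f\<^sub>k powr (p - 1) \<le> b\<^sub>k powr (p - 1) = \<nu>(B(x,r\<^sub>k)) / r\<^sub>k powr (n - p)\<close>. The
remaining one is moved under the integral over \<open>B(z, 2 r\<^sub>k)\<close>, each of whose points is within \<open>3 r\<^sub>k\<close> of \<open>x\<close>.
\<close>

lemma energy_density_ge:
  assumes "x \<in> X" "k < N" "dist x z < R / 2 ^ k"
  shows "ennreal ((stopped_term \<nu> p R \<theta> k x / (R / 2 ^ k)) powr p) \<le> energy_density X N z"
proof -
  let ?r = "R / 2 ^ k" and ?f = "stopped_term \<nu> p R \<theta> k x" and ?n = "real DIM('a)"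
  have r: "?r > 0" using R by simp
  have f: "0 \<le> ?f" by (rule stopped_term_bounds)
  have sub: "ball x ?r \<subseteq> ball z (2 * ?r)"
  proof
    fix y assume "y \<in> ball x ?r"
    then show "y \<in> ball z (2 * ?r)" using assms(3) dist_triangle[of z y x] by (simp add: dist_commute)
  qed
  have "(?f / ?r) powr p = ?f powr 1 * ?f powr (p - 1) / ?r powr p"
    using f R by (simp only: powr_divide powr_add[symmetric]) simp
  also have "\<dots> \<le> ?f powr 1 * dyadic_term \<nu> p R k x powr (p - 1) / ?r powr p"
    using f p stopped_term_bounds(2)[of k x]
    by (intro divide_right_mono mult_left_mono powr_mono2) auto
  also have "dyadic_term \<nu> p R k x powr (p - 1) = measure \<nu> (ball x ?r) / ?r powr (?n - p)"
    using p by (simp add: dyadic_term_def powr_powr)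
  also have "?f powr 1 * (measure \<nu> (ball x ?r) / ?r powr (?n - p)) / ?r powr p
      = ?f * measure \<nu> (ball x ?r) / ?r ^ DIM('a)"
    using f r R by (simp add: powr_realpow flip: powr_add)
  also have "\<dots> \<le> ?f * measure \<nu> (ball z (2 * ?r)) / ?r ^ DIM('a)"
    using f r by (intro divide_right_mono mult_left_mono measure_ball_mono[OF sub]) auto
  finally have "ennreal ((?f / ?r) powr p) \<le> ennreal (1 / ?r ^ DIM('a) * (?f * measure \<nu> (ball z (2 * ?r))))"
    by (intro ennreal_leI) simp
  also have "\<dots> = ennreal (1 / ?r ^ DIM('a)) * (ennreal ?f * emeasure \<nu> (ball z (2 * ?r)))"
    using f R by (simp only: ennreal_mult emeasure_eq_measure measure_nonneg mult_nonneg_nonneg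
        divide_nonneg_pos zero_less_power r zero_le_one)
  also have "ennreal ?f * emeasure \<nu> (ball z (2 * ?r)) = (\<integral>\<^sup>+y. ennreal ?f * indicator (ball z (2 * ?r)) y \<partial>\<nu>)"
    by (subst nn_integral_cmult_indicator) (auto simp: sets_\<nu>)
  also have "\<dots> \<le> (\<integral>\<^sup>+y. nearby_term X k y * indicator (ball z (2 * ?r)) y \<partial>\<nu>)"
  proof (rule nn_integral_mono)
    fix y
    show "ennreal ?f * indicator (ball z (2 * ?r)) y \<le> nearby_term X k y * indicator (ball z (2 * ?r)) y"
    proof (cases "y \<in> ball z (2 * ?r)")
      case True
      then have "y \<in> ball x (3 * ?r)" using assms(3) dist_triangle[of x y z] by simp
      then have "ennreal ?f \<le> nearby_term X k y"
        unfolding nearby_term_def by (intro SUP_upper2[OF assms(1)]) simp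
      then show ?thesis by (intro mult_right_mono) auto
    qed simp
  qed
  also have "ennreal (1 / ?r ^ DIM('a)) * (\<integral>\<^sup>+y. nearby_term X k y * indicator (ball z (2 * ?r)) y \<partial>\<nu>)
     \<le> energy_density X N z"
    unfolding energy_density_def using assms(2)
    by (intro member_le_sum[where f = "\<lambda>k. ennreal (1 / (R / 2 ^ k) ^ DIM('a)) *
       (\<integral>\<^sup>+y. nearby_term X k y * indicator (ball z (2 * (R / 2 ^ k))) y \<partial>\<nu>)"]) auto
  finally show ?thesis by (simp add: mult_left_mono)
qed

lemma ball_indicator_measurable:
  "(\<lambda>(z, y). indicator (ball z r) y :: ennreal) \<in> borel_measurable (lborel \<Otimes>\<^sub>M \<nu>)"
proof -
  have "open {w::'a \<times> 'a. dist (fst w) (snd w) < r}"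
    by (intro open_Collect_less continuous_intros)
  then have "{w::'a \<times> 'a. dist (fst w) (snd w) < r} \<in> sets (borel \<Otimes>\<^sub>M borel)"
    unfolding borel_prod by (rule borel_open)
  also have "sets (borel \<Otimes>\<^sub>M borel) = sets (lborel \<Otimes>\<^sub>M \<nu>)"
    by (intro sets_pair_measure_cong) (auto simp: sets_\<nu>)
  finally have "indicator {w::'a \<times> 'a. dist (fst w) (snd w) < r} \<in> borel_measurable (lborel \<Otimes>\<^sub>M \<nu>)"
    by (rule borel_measurable_indicator)
  then show ?thesis
    by (rule measurable_cong[THEN iffD1, rotated]) (auto simp: indicator_def)
qed

lemma ball_integral_measurable:
  assumes X: "countable X"
  shows "(\<lambda>(z, y). nearby_term X k y * indicator (ball z r) y) \<in> borel_measurable (lborel \<Otimes>\<^sub>M \<nu>)"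
    and "(\<lambda>z. \<integral>\<^sup>+y. nearby_term X k y * indicator (ball z r) y \<partial>\<nu>) \<in> borel_measurable lborel"
proof -
  have [measurable]: "nearby_term X k \<in> borel_measurable \<nu>"
    using nearby_term_measurable[OF X] sets_\<nu> by (simp cong: measurable_cong_sets)
  have [measurable]: "(\<lambda>w. indicator (ball (fst w) r) (snd w) :: ennreal) \<in> borel_measurable (lborel \<Otimes>\<^sub>M \<nu>)"
    using ball_indicator_measurable[of r] by (simp add: split_def)
  show *: "(\<lambda>(z, y). nearby_term X k y * indicator (ball z r) y) \<in> borel_measurable (lborel \<Otimes>\<^sub>M \<nu>)"
    unfolding split_def by measurable
  show "(\<lambda>z. \<integral>\<^sup>+y. nearby_term X k y * indicator (ball z r) y \<partial>\<nu>) \<in> borel_measurable lborel"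
    by (rule sigma_finite_measure.borel_measurable_nn_integral[OF finite_measure.axioms(1)[OF finite_\<nu>] *])
qed

lemma energy_density_measurable:
  assumes "countable X"
  shows "energy_density X N \<in> borel_measurable lborel"
proof -
  note [measurable] = ball_integral_measurable(2)[OF assms]
  show ?thesis unfolding energy_density_def[abs_def] by measurable
qed

text \<open>
Integrating in \<open>z\<close> first replaces the indicator of \<open>B(z, 2 r\<^sub>k)\<close> by the volume \<open>V 2^n r\<^sub>k^n\<close>, which cancels the factor \<open>r\<^sub>k^(- n)\<close>; what
is left is the integral of the sum bounded in \<open>nearby_term_sum\<close>.
\<close>

lemma energy_density_integral:
  assumes X: "countable X"
  shows "(\<integral>\<^sup>+z. energy_density X N z \<partial>lborel)
    \<le> ennreal (unit_ball_vol (real DIM('a)) * 2 ^ DIM('a)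
        * ((3 + 8 powr ((real DIM('a) - p) / (p - 1))) * \<theta>) * measure \<nu> UNIV)"
proof -
  interpret pair_sigma_finite lborel \<nu> ..
  let ?V = "unit_ball_vol (real DIM('a)) * 2 ^ DIM('a)"
  let ?c = "(3 + 8 powr ((real DIM('a) - p) / (p - 1))) * \<theta>"
  have V: "?V \<ge> 0" by (simp add: unit_ball_vol_nonneg)
  have c: "?c \<ge> 0" using \<theta> by (simp add: add_nonneg_nonneg)
  have meas [measurable]: "nearby_term X k \<in> borel_measurable \<nu>" for k
    using nearby_term_measurable[OF X] sets_\<nu> by (simp cong: measurable_cong_sets)
  note m3 = ball_integral_measurable(1)[OF X] and m4 = ball_integral_measurable(2)[OF X]
  have one: "(\<integral>\<^sup>+z. (\<integral>\<^sup>+y. nearby_term X k y * indicator (ball z (2 * (R / 2 ^ k))) y \<partial>\<nu>) \<partial>lborel)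
      = ennreal (?V * (R / 2 ^ k) ^ DIM('a)) * (\<integral>\<^sup>+y. nearby_term X k y \<partial>\<nu>)" for k
  proof -
    have "(\<integral>\<^sup>+z. (\<integral>\<^sup>+y. nearby_term X k y * indicator (ball z (2 * (R / 2 ^ k))) y \<partial>\<nu>) \<partial>lborel)
      = (\<integral>\<^sup>+y. (\<integral>\<^sup>+z. nearby_term X k y * indicator (ball z (2 * (R / 2 ^ k))) y \<partial>lborel) \<partial>\<nu>)"
      by (rule Fubini'[symmetric]) (rule m3)
    also have "\<dots> = (\<integral>\<^sup>+y. nearby_term X k y * ennreal (?V * (R / 2 ^ k) ^ DIM('a)) \<partial>\<nu>)"
    proof (rule nn_integral_cong)
      fix y
      have "(\<integral>\<^sup>+z. nearby_term X k y * indicator (ball z (2 * (R / 2 ^ k))) y \<partial>lborel)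
        = (\<integral>\<^sup>+z. nearby_term X k y * indicator (ball y (2 * (R / 2 ^ k))) z \<partial>lborel)"
        by (intro nn_integral_cong) (simp add: indicator_def dist_commute)
      also have "\<dots> = nearby_term X k y * emeasure lborel (ball y (2 * (R / 2 ^ k)))"
        by (rule nn_integral_cmult_indicator) simp
      also have "emeasure lborel (ball y (2 * (R / 2 ^ k))) = ennreal (?V * (R / 2 ^ k) ^ DIM('a))"
        using R by (subst emeasure_ball) (auto simp: power_mult_distrib power_divide mult_ac)
      finally show "(\<integral>\<^sup>+z. nearby_term X k y * indicator (ball z (2 * (R / 2 ^ k))) y \<partial>lborel)
        = nearby_term X k y * ennreal (?V * (R / 2 ^ k) ^ DIM('a))" .
    qed
    also have "\<dots> = (\<integral>\<^sup>+y. nearby_term X k y \<partial>\<nu>) * ennreal (?V * (R / 2 ^ k) ^ DIM('a))"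
      by (rule nn_integral_multc) measurable
    finally show ?thesis by (simp add: mult.commute)
  qed
  have "(\<integral>\<^sup>+z. energy_density X N z \<partial>lborel) =
     (\<Sum>k<N. \<integral>\<^sup>+z. ennreal (1 / (R / 2 ^ k) ^ DIM('a)) *
       (\<integral>\<^sup>+y. nearby_term X k y * indicator (ball z (2 * (R / 2 ^ k))) y \<partial>\<nu>) \<partial>lborel)"
    unfolding energy_density_def using m4 by (intro nn_integral_sum borel_measurable_times) auto
  also have "\<dots> = (\<Sum>k<N. ennreal (1 / (R / 2 ^ k) ^ DIM('a)) *
      (ennreal (?V * (R / 2 ^ k) ^ DIM('a)) * (\<integral>\<^sup>+y. nearby_term X k y \<partial>\<nu>)))"
    by (intro sum.cong refl) (simp only: nn_integral_cmult[OF m4] one)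
  also have "\<dots> = (\<Sum>k<N. ennreal ?V * (\<integral>\<^sup>+y. nearby_term X k y \<partial>\<nu>))"
  proof (intro sum.cong refl)
    fix k
    have "ennreal (1 / (R / 2 ^ k) ^ DIM('a)) * ennreal (?V * (R / 2 ^ k) ^ DIM('a)) = ennreal ?V"
      using R by (subst ennreal_mult[symmetric]) auto
    then show "ennreal (1 / (R / 2 ^ k) ^ DIM('a)) *
      (ennreal (?V * (R / 2 ^ k) ^ DIM('a)) * (\<integral>\<^sup>+y. nearby_term X k y \<partial>\<nu>)) = ennreal ?V * (\<integral>\<^sup>+y. nearby_term X k y \<partial>\<nu>)"
      by (simp only: mult.assoc[symmetric])
  qed
  also have "\<dots> = ennreal ?V * (\<integral>\<^sup>+y. (\<Sum>k<N. nearby_term X k y) \<partial>\<nu>)"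
    by (subst nn_integral_sum) (auto simp: sum_distrib_left)
  also have "\<dots> \<le> ennreal ?V * (\<integral>\<^sup>+y. ennreal ?c \<partial>\<nu>)"
    by (intro mult_left_mono nn_integral_mono nearby_term_sum) auto
  also have "\<dots> = ennreal ?V * (ennreal ?c * ennreal (measure \<nu> UNIV))"
    using sets_eq_imp_space_eq[OF sets_\<nu>] by (simp add: emeasure_eq_measure)
  also have "\<dots> = ennreal (?V * ?c * measure \<nu> UNIV)"
  proof -
    have "ennreal a * (ennreal b * ennreal m) = ennreal (a * b * m)"
      if "0 \<le> a" "0 \<le> b" "0 \<le> m" for a b m using that by (simp add: ennreal_mult mult.assoc)
    from this[OF V c measure_nonneg] show ?thesis .
  qed
  finally show ?thesis .
qed


text \<open>
The sum computed with slightly smaller balls still exceeds \<open>\<theta>\<close>, and those balls stay inside the original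
ones when the centre moves a little.
\<close>

lemma open_dyadic_superlevel: "open {x. dyadic_potential \<nu> p R N x > \<theta>}"
  unfolding open_dist
proof
  fix x assume "x \<in> {x. dyadic_potential \<nu> p R N x > \<theta>}"
  then have x: "dyadic_potential \<nu> p R N x > \<theta>" by simp
  let ?g = "\<lambda>s k. (s / (R / 2 ^ k) powr (real DIM('a) - p)) powr (1 / (p - 1))"
  have ball: "(\<lambda>m. measure \<nu> (ball x (r - 1 / Suc m))) \<longlonglongrightarrow> measure \<nu> (ball x r)" for r
  proof -
    have "(\<lambda>m. measure \<nu> (ball x (r - 1 / Suc m))) \<longlonglongrightarrow> measure \<nu> (\<Union>m. ball x (r - 1 / Suc m))"
    proof (rule finite_Lim_measure_incseq)
      show "incseq (\<lambda>m. ball x (r - 1 / real (Suc m)))"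
        by (intro incseq_SucI subset_ball diff_left_mono divide_left_mono) auto
    qed (auto simp: sets_\<nu>)
    also have "(\<Union>m. ball x (r - 1 / Suc m)) = ball x r"
    proof
      show "(\<Union>m. ball x (r - 1 / Suc m)) \<subseteq> ball x r" by (intro UN_least subset_ball) simp
      show "ball x r \<subseteq> (\<Union>m. ball x (r - 1 / Suc m))"
      proof
        fix y assume "y \<in> ball x r"
        then have "0 < r - dist x y" by simp
        then obtain m where "inverse (real (Suc m)) < r - dist x y" using reals_Archimedean by blast
        then show "y \<in> (\<Union>m. ball x (r - 1 / Suc m))"
          by (intro UN_I[of m]) (auto simp: inverse_eq_divide)
      qed
    qed
    finally show ?thesis .
  qed
  have "(\<lambda>m. \<Sum>k<N. ?g (measure \<nu> (ball x (R / 2 ^ k - 1 / Suc m))) k) \<longlonglongrightarrow>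
      (\<Sum>k<N. ?g (measure \<nu> (ball x (R / 2 ^ k))) k)"
    using p R by (intro tendsto_sum tendsto_powr' tendsto_divide ball tendsto_const) auto
  then have "\<forall>\<^sub>F m in sequentially. \<theta> < (\<Sum>k<N. ?g (measure \<nu> (ball x (R / 2 ^ k - 1 / Suc m))) k)"
    using x by (intro order_tendstoD(1)) (simp_all add: dyadic_potential_def dyadic_term_def)
  then obtain m where m: "\<theta> < (\<Sum>k<N. ?g (measure \<nu> (ball x (R / 2 ^ k - 1 / Suc m))) k)"
    by (auto simp: eventually_sequentially)
  show "\<exists>e>0. \<forall>y. dist y x < e \<longrightarrow> y \<in> {x. dyadic_potential \<nu> p R N x > \<theta>}"
  proof (intro exI[of _ "1 / real (Suc m)"] conjI allI impI)
    fix y assume y: "dist y x < 1 / real (Suc m)"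
    have "ball x (R / 2 ^ k - 1 / Suc m) \<subseteq> ball y (R / 2 ^ k)" for k
    proof
      fix z assume "z \<in> ball x (R / 2 ^ k - 1 / Suc m)"
      then show "z \<in> ball y (R / 2 ^ k)" using y dist_triangle[of y z x] by simp
    qed
    then have "(\<Sum>k<N. ?g (measure \<nu> (ball x (R / 2 ^ k - 1 / Suc m))) k) \<le> dyadic_potential \<nu> p R N y"
      unfolding dyadic_potential_def dyadic_term_def using p
      by (intro sum_mono powr_mono2 divide_right_mono measure_ball_mono) auto
    then show "y \<in> {x. dyadic_potential \<nu> p R N x > \<theta>}" using m by simp
  qed simp
qed


text \<open>
Compactness reduces to finitely many scales, and then to finitely many centres \<open>X\<close>, because the innermost plateau
of each centre has positive radius. The towers \<open>\<psi>\<close> carry the factor \<open>2 / \<theta>\<close>, so they reach height 2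
over \<open>K\<close>; the smooth maximum may then lose 1.
\<close>

lemma cap_compact_superlevel_bound:
  assumes \<phi>: "smooth_on UNIV \<phi>" "\<And>s. (\<phi> has_real_derivative \<phi>' s) (at s)"
      "\<And>s. 0 \<le> \<phi> s" "\<And>s. s \<le> 1/4 \<Longrightarrow> \<phi> s = 1" "\<And>s. s \<ge> 1 \<Longrightarrow> \<phi> s = 0"
      "\<And>s. \<bar>\<phi>' s\<bar> \<le> C" "C > 0" "\<And>s. s \<le> 1/4 \<or> s \<ge> 1 \<Longrightarrow> \<phi>' s = 0"
    and K: "compact K" "\<And>x. x \<in> K \<Longrightarrow> \<exists>N. dyadic_potential \<nu> p R N x > \<theta>"
    and U: "\<And>x. x \<in> K \<Longrightarrow> cball x R \<subseteq> U"
  shows "cap_compact p K U \<le> ennreal ((4 * C / \<theta>) powr p) *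
     ennreal (unit_ball_vol (real DIM('a)) * 2 ^ DIM('a)
        * ((3 + 8 powr ((real DIM('a) - p) / (p - 1))) * \<theta>) * measure \<nu> UNIV)"
proof -
  let ?f = "stopped_term \<nu> p R \<theta>" and ?r = "\<lambda>k. R / 2 ^ k"
  have r: "?r k > 0" "?r k \<le> R" for k using R by (auto simp: field_simps)
  have quarter: "a / \<rho>\<^sup>2 \<le> 1 / 4 \<longleftrightarrow> a \<le> (\<rho> / 2)\<^sup>2" if "\<rho> > 0" for a \<rho> :: real
    using that by (simp add: power_divide divide_le_eq)
  obtain N where N: "\<And>x. x \<in> K \<Longrightarrow> dyadic_potential \<nu> p R N x > \<theta>"
  proof -
    have "K \<subseteq> (\<Union>N. {x. dyadic_potential \<nu> p R N x > \<theta>})" using K(2) by auto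
    then obtain I where I: "finite I" "K \<subseteq> (\<Union>N\<in>I. {x. dyadic_potential \<nu> p R N x > \<theta>})"
      using compactE_image[OF K(1), of UNIV "\<lambda>N. {x. dyadic_potential \<nu> p R N x > \<theta>}"]
        open_dyadic_superlevel by (metis)
    have "dyadic_potential \<nu> p R (Max (insert 0 I)) x > \<theta>" if x: "x \<in> K" for x
    proof -
      obtain M where M: "M \<in> I" "dyadic_potential \<nu> p R M x > \<theta>" using I(2) x by auto
      then show ?thesis
        using dyadic_potential_mono[of M "Max (insert 0 I)" \<nu> p R x] I(1) by auto
    qed
    then show thesis by (rule that)
  qed
  obtain X where X: "finite X" "X \<subseteq> K" "K \<subseteq> (\<Union>x\<in>X. ball x (?r N))"
  proof -
    have "K \<subseteq> (\<Union>x\<in>K. ball x (?r N))" using r by auto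
    then show thesis
      using compactE_image[OF K(1), of K "\<lambda>x. ball x (?r N)"] that by (metis open_ball)
  qed
  define \<psi> where "\<psi> x z = (\<Sum>k<N. 2 * ?f k x / \<theta> * \<phi> (((z - x) \<bullet> (z - x)) / (?r k)\<^sup>2))" for x z
  define G where "G x z =
    (\<Sum>k<N. (2 * ?f k x / \<theta> * (\<phi>' (((z - x) \<bullet> (z - x)) / (?r k)\<^sup>2) * (2 / (?r k)\<^sup>2))) *\<^sub>R (z - x))" for x z
  have smooth: "cont_diff m (\<psi> x)" for m x
  proof -
    have "cont_diff m (\<lambda>z. (z - x) \<bullet> (z - x))"
    proof -
      have "cont_diff m (\<lambda>z. \<Sum>b\<in>Basis. (z \<bullet> b - x \<bullet> b) * (z \<bullet> b - x \<bullet> b))"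
        by (intro cont_diff_sum cont_diff_mult cont_diff_diff cont_diff_inner cont_diff_const)
      moreover have "(\<Sum>b\<in>Basis. (z \<bullet> b - x \<bullet> b) * (z \<bullet> b - x \<bullet> b)) = (z - x) \<bullet> (z - x)" for z
        by (subst euclidean_inner[of "z - x" "z - x"]) (simp only: inner_diff_left)
      ultimately show ?thesis by (simp only:)
    qed
    then have "cont_diff m (\<lambda>z. (z - x) \<bullet> (z - x) * (1 / c))" for c
      by (intro cont_diff_mult cont_diff_const)
    then have "cont_diff m (\<lambda>z. \<phi> (((z - x) \<bullet> (z - x)) / (?r k)\<^sup>2))" for k
      by (intro cont_diff_compose[OF \<phi>(1)]) auto
    then show ?thesis unfolding \<psi>_def[abs_def]
      by (intro cont_diff_sum cont_diff_mult cont_diff_const)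
  qed
  have deriv: "(\<psi> x has_derivative (\<lambda>h. h \<bullet> G x z)) (at z)" for x z
  proof -
    have "((\<lambda>z. ((z - x) \<bullet> (z - x)) / c) has_derivative (\<lambda>h. h \<bullet> ((2 / c) *\<^sub>R (z - x)))) (at z)" for c
    proof -
      have "((\<lambda>z. (z - x) \<bullet> (z - x)) has_derivative (\<lambda>h. 2 * (h \<bullet> (z - x)))) (at z)"
        by (auto intro!: derivative_eq_intros simp: inner_commute)
      from has_derivative_mult_left[OF this, of "1 / c"] show ?thesis
        by (simp add: inner_scaleR_right)
    qed
    from has_derivative_compose[OF this \<phi>(2)[unfolded has_field_derivative_def]]
    have "((\<lambda>z. \<phi> (((z - x) \<bullet> (z - x)) / (?r k)\<^sup>2)) has_derivative
      (\<lambda>h. \<phi>' (((z - x) \<bullet> (z - x)) / (?r k)\<^sup>2) * (h \<bullet> ((2 / (?r k)\<^sup>2) *\<^sub>R (z - x))))) (at z)" for k .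
    then have "(\<psi> x has_derivative (\<lambda>h. \<Sum>k<N. 2 * ?f k x / \<theta> *
       (\<phi>' (((z - x) \<bullet> (z - x)) / (?r k)\<^sup>2) * (h \<bullet> ((2 / (?r k)\<^sup>2) *\<^sub>R (z - x)))))) (at z)"
      unfolding \<psi>_def[abs_def] by (intro has_derivative_sum has_derivative_mult_right)
    then show ?thesis by (simp add: G_def inner_sum_right mult_ac)
  qed
  obtain u where u: "\<And>k. cont_diff k u" "\<And>x z. x \<in> X \<Longrightarrow> \<psi> x z - 1 \<le> u z"
    "\<And>z. u z \<noteq> 0 \<Longrightarrow> \<exists>x\<in>X. \<psi> x z \<noteq> 0"
    "\<And>z. gradient u z = 0 \<or> (\<exists>x\<in>X. norm (gradient u z) \<le> norm (G x z))"
    using smooth_maximum[OF X(1), of \<psi> G 1] smooth deriv by auto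
  have u_ge: "1 \<le> u z" if zK: "z \<in> K" for z
  proof -
    obtain x where x: "x \<in> X" "dist x z < ?r N" using X(3) zK by auto
    have "\<phi> (((z - x) \<bullet> (z - x)) / (?r k)\<^sup>2) = 1" if "k < N" for k
    proof (rule \<phi>(4))
      have "(2::real) ^ N \<ge> 2 ^ Suc k" using that by (intro power_increasing) auto
      then have "?r N \<le> ?r k / 2" using R by (simp add: field_simps)
      then have "norm (z - x) \<le> ?r k / 2" using x(2) by (simp add: dist_norm norm_minus_commute)
      then have "(norm (z - x))\<^sup>2 \<le> (?r k / 2)\<^sup>2" by (intro power_mono) auto
      then show "((z - x) \<bullet> (z - x)) / (?r k)\<^sup>2 \<le> 1 / 4"
        unfolding power2_norm_eq_inner[symmetric] quarter[OF r(1)] .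
    qed
    then have "\<psi> x z = 2 / \<theta> * (\<Sum>k<N. ?f k x)" by (simp add: \<psi>_def sum_distrib_left)
    also have "(\<Sum>k<N. ?f k x) \<ge> \<theta>"
      using stopped_sum[of \<theta> \<nu> p R N x] N[of x] x X(2) \<theta> by auto
    then have "2 / \<theta> * (\<Sum>k<N. ?f k x) \<ge> 2 / \<theta> * \<theta>" using \<theta> by (intro mult_left_mono) auto
    finally have "\<psi> x z \<ge> 2" using \<theta> by simp
    then show ?thesis using u(2)[OF x(1), of z] by simp
  qed
  have supp: "closure {z. u z \<noteq> 0} \<subseteq> (\<Union>x\<in>X. cball x R)"
  proof (rule closure_minimal)
    show "closed (\<Union>x\<in>X. cball x R)" using X(1) by (intro closed_UN) auto
    show "{z. u z \<noteq> 0} \<subseteq> (\<Union>x\<in>X. cball x R)"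
    proof
      fix z assume "z \<in> {z. u z \<noteq> 0}"
      then obtain x where x: "x \<in> X" "\<psi> x z \<noteq> 0" using u(3) by auto
      have "dist x z \<le> R"
      proof (rule ccontr)
        assume "\<not> dist x z \<le> R"
        then have "norm (z - x) \<ge> ?r k" for k using r(2)[of k] by (simp add: dist_norm norm_minus_commute)
        then have "(norm (z - x))\<^sup>2 \<ge> (?r k)\<^sup>2" for k using r(1)[of k] by (intro power_mono) auto
        then have "((z - x) \<bullet> (z - x)) / (?r k)\<^sup>2 \<ge> 1" for k
          unfolding power2_norm_eq_inner[symmetric] using R by (simp add: le_divide_eq)
        then have "\<psi> x z = 0" unfolding \<psi>_def by (intro sum.neutral) (use \<phi>(5) in auto)
        then show False using x by simp
      qed
      then show "z \<in> (\<Union>x\<in>X. cball x R)" using x by auto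
    qed
  qed
  have "compact (\<Union>x\<in>X. cball x R)" using X(1) by (intro compact_UN) auto
  then have "compact (closure {z. u z \<noteq> 0})"
    using supp by (metis closed_closure compact_Int_closed inf.absorb_iff2)
  moreover have "closure {z. u z \<noteq> 0} \<subseteq> U" using supp U X(2) by blast
  ultimately have test: "u \<in> test_functions U" using u(1) by (simp add: test_functions_def)
  have "cap_compact p K U \<le> (\<integral>\<^sup>+z\<in>U. ennreal (norm (gradient u z) powr p) \<partial>lborel)"
    unfolding cap_compact_def using test u_ge by (intro INF_lower) auto
  also have "\<dots> \<le> (\<integral>\<^sup>+z. ennreal ((4 * C / \<theta>) powr p) * energy_density X N z \<partial>lborel)"
  proof (rule nn_integral_mono)
    fix z
    have "ennreal (norm (gradient u z) powr p) \<le> ennreal ((4 * C / \<theta>) powr p) * energy_density X N z"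
    proof (cases "gradient u z = 0")
      case False
      then obtain x where x: "x \<in> X" "norm (gradient u z) \<le> norm (G x z)" using u(4) by auto
      have G0: "\<phi>' (((z - x) \<bullet> (z - x)) / (?r k)\<^sup>2) = 0" if "\<not> (?r k / 2 < dist x z \<and> dist x z < ?r k)" for k
      proof (rule \<phi>(8))
        have "norm (z - x) \<le> ?r k / 2 \<or> norm (z - x) \<ge> ?r k"
          using that by (auto simp: dist_norm norm_minus_commute)
        then have "(norm (z - x))\<^sup>2 \<le> (?r k / 2)\<^sup>2 \<or> (norm (z - x))\<^sup>2 \<ge> (?r k)\<^sup>2"
          using r(1)[of k] by (auto intro: power_mono)
        then show "((z - x) \<bullet> (z - x)) / (?r k)\<^sup>2 \<le> 1 / 4 \<or> ((z - x) \<bullet> (z - x)) / (?r k)\<^sup>2 \<ge> 1"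
          unfolding power2_norm_eq_inner[symmetric] quarter[OF r(1)] using R
          by (simp add: le_divide_eq)
      qed
      \<comment> \<open>Only the scale with \<open>r k / 2 < dist x z < r k\<close> contributes to the gradient of the tower at \<open>z\<close>.\<close>
      show ?thesis
      proof (cases "\<exists>k<N. ?r k / 2 < dist x z \<and> dist x z < ?r k")
        case True
        then obtain k where k: "k < N" "?r k / 2 < dist x z" "dist x z < ?r k" by auto
        have other: "\<phi>' (((z - x) \<bullet> (z - x)) / (?r j)\<^sup>2) = 0" if "j \<noteq> k" for j
        proof (rule G0)
          have half: "?r b \<le> ?r a / 2" if "a < b" for a b
          proof -
            have "(2::real) ^ b \<ge> 2 ^ Suc a" using that by (intro power_increasing) auto
            then show ?thesis using R by (simp add: field_simps)
          qed
          show "\<not> (?r j / 2 < dist x z \<and> dist x z < ?r j)"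
            using half[of j k] half[of k j] k that by (cases "j < k") auto
        qed
        let ?s = "((z - x) \<bullet> (z - x)) / (?r k)\<^sup>2"
        have "G x z = (2 * ?f k x / \<theta> * (\<phi>' ?s * (2 / (?r k)\<^sup>2))) *\<^sub>R (z - x)"
          unfolding G_def using k(1) other
          by (subst sum.remove[of _ k]) (auto intro!: sum.neutral)
        then have "norm (G x z) = 2 * ?f k x / \<theta> * (\<bar>\<phi>' ?s\<bar> * (2 / (?r k)\<^sup>2)) * norm (z - x)"
          using \<theta> stopped_term_bounds(1)[of k x] by (simp add: abs_mult)
        also have "\<dots> \<le> 2 * ?f k x / \<theta> * (C * (2 / (?r k)\<^sup>2)) * ?r k"
          using \<theta> stopped_term_bounds(1)[of k x] \<phi>(6)[of ?s] \<phi>(7) k(3) r(1)[of k]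
          by (intro mult_mono mult_left_mono mult_right_mono) (auto simp: dist_norm norm_minus_commute)
        also have "\<dots> = 4 * C / \<theta> * (?f k x / ?r k)"
          using r(1)[of k] R by (simp add: power2_eq_square field_simps)
        finally have "norm (gradient u z) powr p \<le> (4 * C / \<theta> * (?f k x / ?r k)) powr p"
          using x(2) p by (intro powr_mono2) auto
        also have "\<dots> = (4 * C / \<theta>) powr p * (?f k x / ?r k) powr p" by (rule powr_mult)
        finally have "ennreal (norm (gradient u z) powr p) \<le> ennreal ((4 * C / \<theta>) powr p) * ennreal ((?f k x / ?r k) powr p)"
          by (simp add: ennreal_leI flip: ennreal_mult)
        also have "\<dots> \<le> ennreal ((4 * C / \<theta>) powr p) * energy_density X N z"
          by (intro mult_left_mono energy_density_ge[OF x(1) k(1,3)]) simp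
        finally show ?thesis .
      next
        case False
        then have "G x z = 0" unfolding G_def using G0 by (intro sum.neutral) auto
        then show ?thesis using x(2) by simp
      qed
    qed simp
    then show "ennreal (norm (gradient u z) powr p) * indicator U z
        \<le> ennreal ((4 * C / \<theta>) powr p) * energy_density X N z"
      by (auto simp: indicator_def)
  qed
  also have "\<dots> = ennreal ((4 * C / \<theta>) powr p) * (\<integral>\<^sup>+z. energy_density X N z \<partial>lborel)"
    by (rule nn_integral_cmult) (use energy_density_measurable X(1) in \<open>auto intro: countable_finite\<close>)
  also have "\<dots> \<le> ennreal ((4 * C / \<theta>) powr p) *
     ennreal (unit_ball_vol (real DIM('a)) * 2 ^ DIM('a)
        * ((3 + 8 powr ((real DIM('a) - p) / (p - 1))) * \<theta>) * measure \<nu> UNIV)"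
    by (intro mult_left_mono energy_density_integral countable_finite X(1)) simp
  finally show ?thesis .
qed

end

text \<open>
The weak type estimate. The constant depends on \<open>p\<close> and the dimension only, which is what allows applying it at infinitely many scales
and sums over them. The set \<open>V\<close> confines the superlevel set so that the supports of the test functions stay in \<open>U\<close>.
\<close>

lemma cap_superlevel_bound:
  fixes p :: real
  assumes p: "1 < p"
  obtains C where "C > 0"
    "\<And>(\<nu> :: 'a::euclidean_space measure) R \<theta> U V E.
      \<lbrakk>sets \<nu> = sets borel; finite_measure \<nu>; 0 < R; 0 < \<theta>; open V;
       \<And>x. x \<in> V \<Longrightarrow> cball x R \<subseteq> U;
       E \<subseteq> {x \<in> V. \<exists>N. \<theta> < dyadic_potential \<nu> p R N x}\<rbrakk>
      \<Longrightarrow> cap p E U \<le> ennreal (C * measure \<nu> UNIV / \<theta> powr (p - 1))"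
proof -
  obtain \<phi> \<phi>' C where \<phi>: "smooth_on UNIV \<phi>" "\<And>s. (\<phi> has_real_derivative \<phi>' s) (at s)"
      "\<And>s. 0 \<le> \<phi> s" "\<And>s. s \<le> 1/4 \<Longrightarrow> \<phi> s = 1" "\<And>s. s \<ge> 1 \<Longrightarrow> \<phi> s = 0"
      "\<And>s. \<bar>\<phi>' s\<bar> \<le> C" "C > 0" "\<And>s. s \<le> 1/4 \<or> s \<ge> 1 \<Longrightarrow> \<phi>' s = 0"
    using smooth_cutoff_exists by metis
  define D where "D = unit_ball_vol (real DIM('a)) * 2 ^ DIM('a)
    * (3 + 8 powr ((real DIM('a) - p) / (p - 1)))"
  have D: "D > 0" unfolding D_def by (intro mult_pos_pos add_pos_nonneg) (auto simp: unit_ball_vol_pos)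
  show thesis
  proof (rule that[of "(4 * C) powr p * D"])
    show "(4 * C) powr p * D > 0" using D \<phi>(7) by simp
    fix \<nu> :: "'a measure" and R \<theta> :: real and U V E :: "'a set"
    assume \<nu>: "sets \<nu> = sets borel" "finite_measure \<nu>" and R: "0 < R" and \<theta>: "0 < \<theta>" and V: "open V"
      and U: "\<And>x. x \<in> V \<Longrightarrow> cball x R \<subseteq> U"
      and E: "E \<subseteq> {x \<in> V. \<exists>N. \<theta> < dyadic_potential \<nu> p R N x}"
    let ?G = "V \<inter> (\<Union>N. {x. \<theta> < dyadic_potential \<nu> p R N x})"
    have G: "open ?G"
      using V open_dyadic_superlevel[OF \<nu> p R \<theta>] by (intro open_Int open_UN) auto
    moreover have "?G \<subseteq> U" using U R by force
    moreover have "E \<subseteq> ?G" using E by auto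
    ultimately have "cap p E U \<le> (SUP K\<in>{K. compact K \<and> K \<subseteq> ?G}. cap_compact p K U)"
      unfolding cap_def by (intro INF_lower) auto
    also have "\<dots> \<le> ennreal ((4 * C / \<theta>) powr p) * ennreal (D * \<theta> * measure \<nu> UNIV)"
    proof (rule SUP_least)
      fix K assume "K \<in> {K. compact K \<and> K \<subseteq> ?G}"
      then have K: "compact K" "K \<subseteq> ?G" by auto
      have "cap_compact p K U \<le> ennreal ((4 * C / \<theta>) powr p) *
        ennreal (unit_ball_vol (real DIM('a)) * 2 ^ DIM('a)
          * ((3 + 8 powr ((real DIM('a) - p) / (p - 1))) * \<theta>) * measure \<nu> UNIV)"
        by (rule cap_compact_superlevel_bound[OF \<nu> p R \<theta> \<phi> K(1)]) (use K(2) U in auto)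
      then show "cap_compact p K U \<le> ennreal ((4 * C / \<theta>) powr p) * ennreal (D * \<theta> * measure \<nu> UNIV)"
        by (simp only: D_def mult.assoc)
    qed
    also have "\<dots> = ennreal ((4 * C / \<theta>) powr p * (D * \<theta> * measure \<nu> UNIV))"
      using D \<theta> by (subst ennreal_mult) auto
    also have "(4 * C / \<theta>) powr p * (D * \<theta> * measure \<nu> UNIV)
        = (4 * C) powr p * D * measure \<nu> UNIV / \<theta> powr (p - 1)"
      using \<theta> by (simp add: powr_divide powr_diff)
    finally show "cap p E U \<le> ennreal ((4 * C) powr p * D * measure \<nu> UNIV / \<theta> powr (p - 1))" .
  qed
qed

section \<open>A lower bound for the capacity of spheres\<close>

lemma gradient_inner_Basis: "b \<in> Basis \<Longrightarrow> gradient u x \<bullet> b = frechet_derivative u (at x) b"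
  by (simp add: gradient_def)

lemma continuous_gradient:
  assumes "cont_diff (Suc 0) u"
  shows "continuous_on UNIV (gradient u)"
proof -
  have "gradient u = (\<lambda>x. \<Sum>b\<in>Basis. frechet_derivative u (at x) b *\<^sub>R b)"
    by (simp add: gradient_def fun_eq_iff)
  then show ?thesis using assms
    by (simp only:) (intro continuous_on_sum continuous_on_scaleR continuous_on_const, simp)
qed

lemma gradient_outside_support:
  assumes "z \<notin> closure {x. u x \<noteq> 0}"
  shows "gradient u z = 0"
proof (rule gradient_eqI)
  have "((\<lambda>x. 0) has_derivative (\<lambda>h. 0)) (at z)" by simp
  then have "(u has_derivative (\<lambda>h. 0)) (at z)"
    by (rule has_derivative_transform_within_open[where s = "- closure {x. u x \<noteq> 0}"])
      (use assms closure_subset[of "{x. u x \<noteq> 0}"] in auto)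
  then show "(u has_derivative (\<lambda>h. h \<bullet> 0)) (at z)" by simp
qed

lemma nn_integral_lborel_translate:
  fixes g :: "'a::euclidean_space \<Rightarrow> ennreal"
  assumes "g \<in> borel_measurable borel"
  shows "(\<integral>\<^sup>+x. g (x + c) \<partial>lborel) = (\<integral>\<^sup>+x. g x \<partial>lborel)"
proof -
  have "(\<integral>\<^sup>+x. g x \<partial>lborel) = (\<integral>\<^sup>+x. g x \<partial>distr lborel borel ((+) c))"
    by (simp add: lborel_distr_plus)
  also have "\<dots> = (\<integral>\<^sup>+x. g (c + x) \<partial>lborel)"
    using assms by (intro nn_integral_distr) auto
  finally show ?thesis by (simp add: add.commute)
qed

text \<open>
A substitute for the inequality of Hoelder on an interval: either \<open>y\<close> is below the threshold \<open>c\<close> or it is dominated by its \<open>p\<close>-th power.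
\<close>

lemma young_split:
  fixes y c p :: real
  assumes "1 < p" "0 < c" "0 \<le> y"
  shows "y \<le> c + c powr (1 - p) * y powr p"
proof (cases "y \<le> c")
  case False
  then have y: "y > 0" "c < y" using assms by auto
  have "1 \<le> (y / c) powr (p - 1)" using y assms by (intro ge_one_powr_ge_zero) auto
  then have "y * 1 \<le> y * (y / c) powr (p - 1)" using y by (intro mult_left_mono) auto
  also have "\<dots> = c powr (1 - p) * y powr p"
    using y assms by (simp add: powr_divide powr_diff)
  finally show ?thesis using assms by simp
qed (use assms in \<open>simp add: add_increasing2\<close>)

lemma line_energy_ge:
  fixes u :: "'a::euclidean_space \<Rightarrow> real"
  assumes u: "cont_diff (Suc 0) u" and e: "e \<in> Basis" and p: "1 < p" and L: "0 \<le> s" "s \<le> L" "0 < L"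
    and jump: "1 \<le> u (x + s *\<^sub>R e) - u (x + L *\<^sub>R e)"
  shows "ennreal ((2 * L) powr (1 - p) / 2)
    \<le> (\<integral>\<^sup>+t. ennreal (norm (gradient u (x + t *\<^sub>R e)) powr p) * indicator {0..L} t \<partial>lborel)"
proof -
  let ?D = "\<lambda>t. gradient u (x + t *\<^sub>R e) \<bullet> e" and ?g = "\<lambda>t. norm (gradient u (x + t *\<^sub>R e))"
  have cont: "continuous_on A (\<lambda>t. gradient u (x + t *\<^sub>R e))" for A
    by (rule continuous_on_compose2[OF continuous_gradient[OF u]]) (auto intro!: continuous_intros)
  have "((\<lambda>t. u (x + t *\<^sub>R e)) has_vector_derivative ?D t) (at t within A)" for t A
  proof -
    have "((\<lambda>t. u (x + t *\<^sub>R e)) has_derivative (\<lambda>h. frechet_derivative u (at (x + t *\<^sub>R e)) (h *\<^sub>R e))) (at t within A)"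
      by (rule has_derivative_compose[OF _ cont_diff_has_derivative[OF u], where f = "\<lambda>t. x + t *\<^sub>R e" and f' = "\<lambda>h. h *\<^sub>R e"])
        (auto intro!: derivative_eq_intros)
    moreover have "frechet_derivative u (at z) (h *\<^sub>R e) = h * (gradient u z \<bullet> e)" for h z
      using linear_cmul[OF has_derivative_linear[OF cont_diff_has_derivative[OF u]], of z h e] e
      by (simp add: gradient_inner_Basis)
    ultimately show ?thesis by (simp add: has_vector_derivative_def)
  qed
  then have ftc: "(?D has_integral (u (x + L *\<^sub>R e) - u (x + s *\<^sub>R e))) {s..L}"
    using L by (intro fundamental_theorem_of_calculus) auto
  have int: "(\<lambda>t. ?g t) integrable_on {s..L}"
    using cont by (intro integrable_continuous_real continuous_on_norm)
  have "norm (integral {s..L} ?D) \<le> integral {s..L} ?g"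
    using ftc e Cauchy_Schwarz_ineq2[of _ e]
    by (intro integral_norm_bound_integral int) (auto simp: has_integral_integrable)
  then have ge1: "1 \<le> integral {s..L} ?g"
    using integral_unique[OF ftc] jump by simp
  have [measurable]: "(\<lambda>t. gradient u (x + t *\<^sub>R e)) \<in> borel_measurable borel"
    using cont[of UNIV] by (rule borel_measurable_continuous_onI)
  let ?A = "\<integral>\<^sup>+t. ennreal (?g t powr p) * indicator {0..L} t \<partial>lborel"
  \<comment> \<open>With this threshold the constant part of \<open>young_split\<close> uses up only half of the total variation 1.\<close>
  let ?c = "1 / (2 * L)"
  have "ennreal 1 \<le> ennreal (integral {s..L} ?g)" using ge1 by (rule ennreal_leI)
  also have "\<dots> = (\<integral>\<^sup>+t. ennreal (?g t) * indicator {s..L} t \<partial>lborel)"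
    using int by (intro nn_integral_has_integral_lebesgue'[symmetric]) auto
  also have "\<dots> \<le> (\<integral>\<^sup>+t. ennreal ?c * indicator {0..L} t
      + ennreal (?c powr (1 - p)) * (ennreal (?g t powr p) * indicator {0..L} t) \<partial>lborel)"
  proof (rule nn_integral_mono)
    fix t
    have "ennreal (?g t) \<le> ennreal (?c + ?c powr (1 - p) * ?g t powr p)"
      using L p by (intro ennreal_leI young_split) auto
    also have "\<dots> = ennreal ?c + ennreal (?c powr (1 - p)) * ennreal (?g t powr p)"
      using L by (simp add: ennreal_mult)
    finally show "ennreal (?g t) * indicator {s..L} t \<le> ennreal ?c * indicator {0..L} t
      + ennreal (?c powr (1 - p)) * (ennreal (?g t powr p) * indicator {0..L} t)"
      using L by (auto simp: indicator_def)
  qed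
  also have "\<dots> = (\<integral>\<^sup>+t. ennreal ?c * indicator {0..L} t \<partial>lborel)
      + (\<integral>\<^sup>+t. ennreal (?c powr (1 - p)) * (ennreal (?g t powr p) * indicator {0..L} t) \<partial>lborel)"
    by (rule nn_integral_add) measurable
  also have "(\<integral>\<^sup>+t. ennreal ?c * indicator {0..L} t \<partial>lborel) = ennreal (1 / 2)"
    using L by (subst nn_integral_cmult_indicator) (auto simp flip: ennreal_mult)
  also have "(\<integral>\<^sup>+t. ennreal (?c powr (1 - p)) * (ennreal (?g t powr p) * indicator {0..L} t) \<partial>lborel)
      = ennreal (?c powr (1 - p)) * ?A"
    by (rule nn_integral_cmult) measurable
  finally have *: "ennreal 1 \<le> ennreal (1 / 2) + ennreal (?c powr (1 - p)) * ?A" .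
  show ?thesis
  proof (cases "?A = \<infinity>")
    case False
    then obtain a where a: "?A = ennreal a" "a \<ge> 0" by (cases ?A) auto
    have plus: "ennreal h + ennreal k * ennreal a = ennreal (h + k * a)" if "0 \<le> h" "0 \<le> k" for h k
      using that a by (simp add: ennreal_mult)
    have "ennreal (1 / 2) + ennreal (?c powr (1 - p)) * ennreal a = ennreal (1 / 2 + ?c powr (1 - p) * a)"
      by (rule plus) auto
    then have "ennreal 1 \<le> ennreal (1 / 2 + ?c powr (1 - p) * a)" using * a(1) by metis
    then have "1 \<le> 1 / 2 + ?c powr (1 - p) * a"
      using a(2) L by (subst (asm) ennreal_le_iff) auto
    then have "(2 * L) powr (1 - p) * (1 / 2) \<le> (2 * L) powr (1 - p) * (?c powr (1 - p) * a)"
      by (intro mult_left_mono) auto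
    also have "\<dots> = a" using L by (simp add: powr_mult[symmetric] mult.assoc[symmetric])
    finally show ?thesis using a by (simp add: ennreal_leI)
  qed simp
qed

lemma inverse_le_inverse_ennreal:
  assumes "0 < c" "ennreal c \<le> b"
  shows "inverse b \<le> inverse (ennreal c)"
proof (cases b)
  case (real r)
  then have "c \<le> r" using assms by (simp add: ennreal_le_iff)
  then show ?thesis using assms(1) real by (simp add: inverse_ennreal ennreal_leI le_imp_inverse_le)
qed simp

text \<open>
Every segment of length \<open>4 r\<close> in a fixed coordinate direction that starts in \<open>B(x0, r / 2)\<close> crosses the sphere, where \<open>u \<ge> 1\<close>, and ends outside \<open>B(x0, 2 r)\<close>,
where \<open>u = 0\<close>. Averaging the resulting energy bounds over the starting points, by Tonelli and translation invariance,
gives the correct power of \<open>r\<close>.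
\<close>

lemma cap_compact_sphere_lower_bound:
  fixes p :: real
  assumes p: "1 < p"
  obtains c where "c > 0"
    "\<And>(x0 :: 'a::euclidean_space) r. 0 < r \<Longrightarrow>
       ennreal (c * r powr (real DIM('a) - p)) \<le> cap_compact p (sphere x0 r) (ball x0 (2 * r))"
proof -
  let ?n = "real DIM('a)" and ?V = "unit_ball_vol (real DIM('a))"
  define c where "c = ?V * (1 / 2) powr ?n * 8 powr (1 - p) / 8"
  have V: "?V > 0" by (simp add: unit_ball_vol_pos)
  show thesis
  proof (rule that[of c])
    show "c > 0" using V by (simp add: c_def)
    fix x0 :: 'a and r :: real assume r: "0 < r"
    show "ennreal (c * r powr (?n - p)) \<le> cap_compact p (sphere x0 r) (ball x0 (2 * r))"
      unfolding cap_compact_def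
    proof (rule INF_greatest)
      fix u assume "u \<in> {u \<in> test_functions (ball x0 (2 * r)). \<forall>x\<in>sphere x0 r. 1 \<le> u x}"
      then have u: "cont_diff k u" "closure {x. u x \<noteq> 0} \<subseteq> ball x0 (2 * r)"
        "x \<in> sphere x0 r \<Longrightarrow> 1 \<le> u x" for k x
        by (auto simp: test_functions_def)
      let ?g = "\<lambda>x. ennreal (norm (gradient u x) powr p)"
      let ?I = "\<integral>\<^sup>+x. ?g x \<partial>lborel"
      have [measurable]: "gradient u \<in> borel_measurable borel"
        using continuous_gradient[OF u(1)] by (rule borel_measurable_continuous_onI)
      obtain e :: 'a where e: "e \<in> Basis" by (meson nonempty_Basis ex_in_conv)
      have line: "ennreal ((8 * r) powr (1 - p) / 2) \<le> (\<integral>\<^sup>+t. ?g (x + t *\<^sub>R e) * indicator {0..4 * r} t \<partial>lborel)"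
        if x: "x \<in> ball x0 (r / 2)" for x
      proof -
        let ?h = "\<lambda>t. dist x0 (x + t *\<^sub>R e)"
        have "dist x0 (x + (4 * r) *\<^sub>R e) \<ge> 4 * r - r / 2"
          using x e r norm_triangle_ineq2[of "(4 * r) *\<^sub>R e" "x0 - x"]
          by (simp add: dist_norm algebra_simps norm_minus_commute)
        then have far: "2 * r \<le> ?h (4 * r)" using r by simp
        have "\<exists>t. 0 \<le> t \<and> t \<le> 4 * r \<and> ?h t = r"
          using x r far by (intro IVT') (auto intro!: continuous_intros)
        then obtain t where t: "0 \<le> t" "t \<le> 4 * r" "?h t = r" by auto
        have "x + (4 * r) *\<^sub>R e \<notin> closure {x. u x \<noteq> 0}" using far u(2) by auto
        then have "u (x + (4 * r) *\<^sub>R e) = 0" using closure_subset[of "{x. u x \<noteq> 0}"] by auto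
        moreover have "1 \<le> u (x + t *\<^sub>R e)" using t(3) by (intro u(3)) simp
        ultimately show ?thesis
          using line_energy_ge[OF u(1) e p t(1,2), of x] r by simp
      qed
      have "ennreal ((8 * r) powr (1 - p) / 2) * emeasure lborel (ball x0 (r / 2))
          = (\<integral>\<^sup>+x. ennreal ((8 * r) powr (1 - p) / 2) * indicator (ball x0 (r / 2)) x \<partial>lborel)"
        by (rule nn_integral_cmult_indicator[symmetric]) simp
      also have "\<dots> \<le> (\<integral>\<^sup>+x. (\<integral>\<^sup>+t. ?g (x + t *\<^sub>R e) * indicator {0..4 * r} t \<partial>lborel) \<partial>lborel)"
        using line by (intro nn_integral_mono) (auto simp: indicator_def)
      also have "\<dots> = (\<integral>\<^sup>+t. (\<integral>\<^sup>+x. ?g (x + t *\<^sub>R e) * indicator {0..4 * r} t \<partial>lborel) \<partial>lborel)"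
        by (rule lborel_pair.Fubini') measurable
      also have "\<dots> = (\<integral>\<^sup>+t. ?I * indicator {0..4 * r} t \<partial>lborel)"
      proof (rule nn_integral_cong)
        fix t :: real
        have "(\<integral>\<^sup>+x. ?g (x + t *\<^sub>R e) * indicator {0..4 * r} t \<partial>lborel)
            = (\<integral>\<^sup>+x. ?g (x + t *\<^sub>R e) \<partial>lborel) * indicator {0..4 * r} t"
          by (rule nn_integral_multc) measurable
        also have "(\<integral>\<^sup>+x. ?g (x + t *\<^sub>R e) \<partial>lborel) = ?I"
          by (rule nn_integral_lborel_translate) measurable
        finally show "(\<integral>\<^sup>+x. ?g (x + t *\<^sub>R e) * indicator {0..4 * r} t \<partial>lborel) = ?I * indicator {0..4 * r} t" .
      qed
      also have "\<dots> = ?I * ennreal (4 * r)"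
        using r by (subst nn_integral_cmult_indicator) auto
      finally have *: "ennreal ((8 * r) powr (1 - p) / 2) * emeasure lborel (ball x0 (r / 2)) \<le> ?I * ennreal (4 * r)" .
      have "?I \<ge> ennreal (c * r powr (?n - p))"
      proof (cases "?I = \<infinity>")
        case False
        then obtain a where a: "?I = ennreal a" "a \<ge> 0" by (cases ?I) auto
        have "(8 * r) powr (1 - p) / 2 * (?V * (r / 2) ^ DIM('a)) \<le> a * (4 * r)"
          using * a r V by (simp add: emeasure_ball ennreal_mult[symmetric])
        then have "(8 * r) powr (1 - p) / 2 * (?V * (r / 2) ^ DIM('a)) / (4 * r) \<le> a"
          using r by (simp add: field_simps)
        also have "(8 * r) powr (1 - p) / 2 * (?V * (r / 2) ^ DIM('a)) / (4 * r)
            = c * (r powr (1 - p) * r powr ?n * r powr (- 1))"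
          using r by (simp add: c_def powr_mult powr_realpow[symmetric] powr_divide powr_minus field_simps)
        also have "r powr (1 - p) * r powr ?n * r powr (- 1) = r powr (?n - p)"
          by (simp only: powr_add[symmetric]) (rule arg_cong[where f = "(powr) r"], simp)
        finally show ?thesis using a by (simp add: ennreal_leI)
      qed simp
      also have "?I = (\<integral>\<^sup>+x\<in>ball x0 (2 * r). ?g x \<partial>lborel)"
        using gradient_outside_support[of _ u] u(2) by (intro nn_integral_cong) (force simp: indicator_def)
      finally show "ennreal (c * r powr (?n - p)) \<le> (\<integral>\<^sup>+x\<in>ball x0 (2 * r). ?g x \<partial>lborel)" .
    qed
  qed
qed

section \<open>Summable weights and dyadic annuli\<close>

text \<open>
With \<open>T i\<close> the tail of the series, \<open>d i = 1 / sqrt (T i)\<close> works, since \<open>(T i - T (Suc i)) / sqrt (T i)\<close> is at most twice the telescoping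
difference of the square roots.
\<close>

lemma summable_with_unbounded_weights:
  fixes a :: "nat \<Rightarrow> real"
  assumes "summable a" "\<And>i. 0 \<le> a i"
  obtains d where "\<And>i. 0 < d i" "filterlim d at_top sequentially" "summable (\<lambda>i. a i * d i)"
proof -
  \<comment> \<open>The geometric summand keeps all tails positive.\<close>
  define b where "b i = a i + (1 / 2) ^ i" for i
  have b: "summable b" "\<And>i. 0 < b i"
    unfolding b_def using assms by (auto intro!: summable_add summable_geometric add_nonneg_pos)
  define T where "T i = (\<Sum>j. b (j + i))" for i
  have T_Suc: "T i = b i + T (Suc i)" for i
  proof -
    have "summable (\<lambda>j. b (j + i))" using b(1) by (simp add: summable_iff_shift)
    from suminf_split_head[OF this] show ?thesis by (simp add: T_def)
  qed
  have T_pos: "0 < T i" for i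
    unfolding T_def using b by (intro suminf_pos) (simp_all add: summable_iff_shift)
  have T_lim: "T \<longlonglongrightarrow> 0"
    unfolding T_def[abs_def] by (rule suminf_exist_split2) (rule b(1))
  define d where "d i = 1 / sqrt (T i)" for i
  show thesis
  proof (rule that)
    show "0 < d i" for i using T_pos by (simp add: d_def)
    have "(\<lambda>i. sqrt (T i)) \<longlonglongrightarrow> sqrt 0" using T_lim by (intro tendsto_real_sqrt)
    then have "filterlim (\<lambda>i. sqrt (T i)) (at_right 0) sequentially"
      using T_pos by (auto simp: filterlim_at less_imp_neq[symmetric])
    then show "filterlim d at_top sequentially"
      unfolding d_def[abs_def] inverse_eq_divide[symmetric]
      by (rule filterlim_compose[OF filterlim_inverse_at_top_right])
    have "summable (\<lambda>i. 2 * (sqrt (T i) - sqrt (T (Suc i))))"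
      by (intro summable_mult telescope_summable'[of _ "sqrt 0"] tendsto_real_sqrt T_lim)
    then show "summable (\<lambda>i. a i * d i)"
    proof (rule summable_comparison_test'[where N = 0])
      fix i
      let ?s = "sqrt (T i)" and ?t = "sqrt (T (Suc i))"
      have s: "0 < ?s" "0 \<le> ?t" "?t \<le> ?s" using T_pos[of i] T_pos[of "Suc i"] T_Suc[of i] b(2)[of i] by auto
      have "a i \<le> b i" by (simp add: b_def)
      also have "b i = T i - T (Suc i)" using T_Suc[of i] by simp
      also have "\<dots> = (?s - ?t) * (?s + ?t)"
        using T_pos[of i] T_pos[of "Suc i"] by (simp add: algebra_simps)
      also have "\<dots> \<le> (?s - ?t) * (2 * ?s)" using s by (intro mult_left_mono) auto
      finally have "a i \<le> (?s - ?t) * (2 * ?s)" .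
      moreover have "u / \<sigma> \<le> 2 * (\<sigma> - \<tau>)" if "u \<le> (\<sigma> - \<tau>) * (2 * \<sigma>)" "0 < \<sigma>" for u \<sigma> \<tau> :: real
        using that by (subst pos_divide_le_eq) (simp_all add: algebra_simps)
      ultimately have "a i / ?s \<le> 2 * (?s - ?t)" using s(1) by blast
      then show "norm (a i * d i) \<le> 2 * (?s - ?t)"
        using assms(2)[of i] s by (simp add: d_def)
    qed
  qed
qed

definition annulus :: "'a::euclidean_space \<Rightarrow> nat \<Rightarrow> 'a set" where
  "annulus x0 i = {x. (1 / 2) ^ i / 4 < norm (x - x0) \<and> norm (x - x0) < 2 * (1 / 2) ^ i}"

lemma powi_half: "2 powi (- int i) = (1 / 2 :: real) ^ i"
  by (simp add: power_int_def power_divide inverse_eq_divide)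

lemma powi_half_shifts:
  "2 powi (- int i - 1) = (1 / 2 :: real) ^ i / 2"
  "2 powi (- int i - 2) = (1 / 2 :: real) ^ i / 4"
  "2 powi (- int i + 1) = (2 :: real) * (1 / 2) ^ i"
  by (simp_all add: power_int_diff power_int_add powi_half power_divide)

lemma open_annulus: "open (annulus x0 i)"
  unfolding annulus_def by (intro open_Collect_conj open_Collect_less continuous_intros)

lemma annulus_subset_wide_shell: "annulus x0 i \<subseteq> interior (wide_shell i x0)"
  by (rule interior_maximal[OF _ open_annulus]) (unfold annulus_def wide_shell_def powi_half_shifts, auto)

section \<open>The potential away from small radii\<close>

definition wolff_integrand :: "'a::euclidean_space measure \<Rightarrow> real \<Rightarrow> 'a \<Rightarrow> real \<Rightarrow> real" where
  "wolff_integrand \<mu> p x t =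
     (measure \<mu> (ball x t \<inter> space \<mu>) / t powr (real DIM('a) - p)) powr (1 / (p - 1)) / t"

lemma wolff_potential_eq:
  "wolff_potential \<mu> p x r = (\<integral>\<^sup>+t\<in>{0<..<r}. ennreal (wolff_integrand \<mu> p x t) \<partial>lborel)"
  by (simp add: wolff_potential_def wolff_integrand_def)

lemma wolff_integrand_eq:
  fixes \<mu> :: "'a::euclidean_space measure"
  assumes "0 < t"
  shows "wolff_integrand \<mu> p x t = measure \<mu> (ball x t \<inter> space \<mu>) powr (1 / (p - 1))
      * t powr (- ((real DIM('a) - p) / (p - 1)) - 1)"
proof -
  have "(m / t powr d) powr q / t = m powr q * t powr (- (d * q) - 1)" for m d q
    using assms by (simp add: powr_divide powr_powr powr_diff powr_minus field_simps)
  then show ?thesis by (simp add: wolff_integrand_def)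
qed

lemma norm_diff_at_right: "filterlim (\<lambda>x. norm (x - x0)) (at_right 0) (at (x0::'a::euclidean_space) within S)"
  unfolding filterlim_at
proof
  have "((\<lambda>x. norm (x - x0)) \<longlongrightarrow> norm (x0 - x0)) (at x0 within S)"
    by (intro tendsto_intros)
  then show "((\<lambda>x. norm (x - x0)) \<longlongrightarrow> 0) (at x0 within S)" by simp
  show "\<forall>\<^sub>F x in at x0 within S. norm (x - x0) \<in> {0<..} \<and> norm (x - x0) \<noteq> 0"
    by (auto simp: eventually_at_filter)
qed

text \<open>
The antiderivative \<open>F\<close> is a power when \<open>\<alpha> > 0\<close> and the logarithm when \<open>\<alpha> = 0\<close>.
\<close>

lemma kernel_integral:
  fixes \<rho> \<delta> \<alpha> :: real
  assumes "0 < \<rho>" "\<rho> < \<delta>" and F: "\<And>t. 0 < t \<Longrightarrow> (F has_real_derivative t powr (- \<alpha> - 1)) (at t)"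
  shows "(\<integral>\<^sup>+t\<in>{\<rho><..<\<delta>}. ennreal (t powr (- \<alpha> - 1)) \<partial>lborel) = ennreal (F \<delta> - F \<rho>)"
proof -
  have "((\<lambda>t. t powr (- \<alpha> - 1)) has_integral (F \<delta> - F \<rho>)) {\<rho>..\<delta>}"
    using assms by (intro fundamental_theorem_of_calculus)
      (auto simp flip: has_real_derivative_iff_has_vector_derivative intro: has_field_derivative_at_within)
  then have "((\<lambda>t. t powr (- \<alpha> - 1)) has_integral (F \<delta> - F \<rho>)) {\<rho><..<\<delta>}"
    by (simp add: has_integral_Icc_iff_Ioo)
  then show ?thesis by (intro nn_integral_has_integral_lebesgue') auto
qed

lemma power_weight_kernel_limit:
  fixes \<alpha> \<delta> :: real
  assumes \<alpha>: "0 < \<alpha>" and \<delta>: "0 < \<delta>"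
  shows "((\<lambda>\<rho>. ennreal (\<rho> powr \<alpha>) * (\<integral>\<^sup>+t\<in>{\<rho><..<\<delta>}. ennreal (t powr (- \<alpha> - 1)) \<partial>lborel))
    \<longlongrightarrow> ennreal (1 / \<alpha>)) (at_right 0)"
proof -
  have "\<forall>\<^sub>F \<rho> in at_right 0. 0 \<le> (\<rho>::real)"
    using eventually_at_right_less[of 0] by eventually_elim simp
  then have "((\<lambda>\<rho>::real. \<rho> powr \<alpha>) \<longlongrightarrow> 0 powr \<alpha>) (at_right 0)"
    using \<alpha> by (intro tendsto_powr') auto
  then have "((\<lambda>\<rho>. ennreal ((1 - \<rho> powr \<alpha> * \<delta> powr (- \<alpha>)) / \<alpha>)) \<longlongrightarrow> ennreal ((1 - 0 powr \<alpha> * \<delta> powr (- \<alpha>)) / \<alpha>)) (at_right 0)"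
    using \<alpha> by (intro tendsto_ennrealI tendsto_divide tendsto_diff tendsto_mult tendsto_const) auto
  moreover have "\<forall>\<^sub>F \<rho> in at_right 0. ennreal ((1 - \<rho> powr \<alpha> * \<delta> powr (- \<alpha>)) / \<alpha>) =
     ennreal (\<rho> powr \<alpha>) * (\<integral>\<^sup>+t\<in>{\<rho><..<\<delta>}. ennreal (t powr (- \<alpha> - 1)) \<partial>lborel)"
    using eventually_at_right_real[OF \<delta>]
  proof eventually_elim
    case (elim \<rho>)
    have "(\<integral>\<^sup>+t\<in>{\<rho><..<\<delta>}. ennreal (t powr (- \<alpha> - 1)) \<partial>lborel)
      = ennreal (- (\<delta> powr (- \<alpha>) / \<alpha>) - - (\<rho> powr (- \<alpha>) / \<alpha>))"
      using elim \<alpha> by (intro kernel_integral) (auto intro!: derivative_eq_intros)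
    moreover have "\<delta> powr (- \<alpha>) \<le> \<rho> powr (- \<alpha>)" using elim \<alpha> by (intro powr_mono2') auto
    then have "0 \<le> - (\<delta> powr (- \<alpha>) / \<alpha>) - - (\<rho> powr (- \<alpha>) / \<alpha>)"
      using \<alpha> by (simp add: divide_right_mono)
    moreover have "\<rho> powr \<alpha> * \<rho> powr (- \<alpha>) = 1" using elim by (simp add: powr_minus)
    ultimately show ?case using \<alpha> by (simp add: ennreal_mult[symmetric] field_simps)
  qed
  ultimately show ?thesis
    using \<alpha> by (auto elim: Lim_transform_eventually)
qed

lemma log_weight_kernel_limit:
  fixes \<delta> :: real
  assumes \<delta>: "0 < \<delta>"
  shows "((\<lambda>\<rho>. inverse (ennreal (ln (1 / \<rho>))) * (\<integral>\<^sup>+t\<in>{\<rho><..<\<delta>}. ennreal (t powr (- 0 - 1)) \<partial>lborel))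
    \<longlongrightarrow> ennreal 1) (at_right 0)"
proof -
  have ln: "filterlim (\<lambda>\<rho>::real. ln \<rho>) at_bot (at_right 0)" by (rule ln_at_0)
  have "((\<lambda>\<rho>. ln \<delta> / ln \<rho>) \<longlongrightarrow> 0) (at_right 0)"
    by (intro tendsto_divide_0[OF tendsto_const] filterlim_at_bot_imp_at_infinity ln)
  then have "((\<lambda>\<rho>. ennreal (1 - ln \<delta> / ln \<rho>)) \<longlongrightarrow> ennreal (1 - 0)) (at_right 0)"
    by (intro tendsto_ennrealI tendsto_diff tendsto_const)
  moreover have "\<forall>\<^sub>F \<rho> in at_right 0. ennreal (1 - ln \<delta> / ln \<rho>) =
    inverse (ennreal (ln (1 / \<rho>))) * (\<integral>\<^sup>+t\<in>{\<rho><..<\<delta>}. ennreal (t powr (- 0 - 1)) \<partial>lborel)"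
    using eventually_at_right_real[OF \<delta>] eventually_at_right_real[OF zero_less_one]
  proof eventually_elim
    case (elim \<rho>)
    then have neg: "ln \<rho> < 0" by (intro ln_less_zero) auto
    have "(\<integral>\<^sup>+t\<in>{\<rho><..<\<delta>}. ennreal (t powr (- 0 - 1)) \<partial>lborel) = ennreal (ln \<delta> - ln \<rho>)"
      using elim by (intro kernel_integral) (auto intro!: derivative_eq_intros simp: powr_minus powr_one inverse_eq_divide)
    moreover have "ln (1 / \<rho>) = - ln \<rho>" using elim by (simp add: ln_div)
    then have "inverse (ennreal (ln (1 / \<rho>))) = ennreal (1 / - ln \<rho>)"
      using neg by (simp only:) (subst inverse_ennreal, auto simp: inverse_eq_divide)
    moreover have "ln \<rho> \<le> ln \<delta>" using elim by simp
    ultimately show ?case using neg by (simp add: ennreal_mult[symmetric] field_simps)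
  qed
  ultimately show ?thesis by (auto elim: Lim_transform_eventually)
qed

context
  fixes \<mu> :: "'a::euclidean_space measure" and \<Omega> :: "'a set"
  assumes sets_\<mu>: "sets \<mu> = sets (restrict_space borel \<Omega>)"
    and finite_\<mu>: "finite_measure \<mu>"
begin

interpretation finite_measure \<mu> by (rule finite_\<mu>)

lemma space_\<mu>: "space \<mu> = \<Omega>"
  using sets_eq_imp_space_eq[OF sets_\<mu>] by (simp add: space_restrict_space)

lemma borel_Int_sets_\<mu>: "A \<in> sets borel \<Longrightarrow> A \<inter> space \<mu> \<in> sets \<mu>"
  unfolding space_\<mu> sets_\<mu> by (auto simp: sets_restrict_space)

lemma measure_Int_mono:
  "A \<subseteq> B \<Longrightarrow> A \<in> sets borel \<Longrightarrow> B \<in> sets borel \<Longrightarrow> measure \<mu> (A \<inter> space \<mu>) \<le> measure \<mu> (B \<inter> space \<mu>)"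
  by (intro finite_measure_mono borel_Int_sets_\<mu>) auto

lemma wolff_integrand_measurable [measurable]: "wolff_integrand \<mu> p x \<in> borel_measurable borel"
proof -
  have "(\<lambda>t. measure \<mu> (ball x t \<inter> space \<mu>)) \<in> borel_measurable borel"
    by (intro borel_measurable_mono monoI measure_Int_mono subset_ball) auto
  then show ?thesis unfolding wolff_integrand_def[abs_def] by measurable
qed

lemma mass_near_point:
  assumes "x0 \<in> \<Omega>" "\<eta> > 0"
  obtains \<delta> where "\<delta> > 0" "measure \<mu> (ball x0 \<delta> \<inter> space \<mu>) < measure \<mu> {x0} + \<eta>"
proof -
  have "(\<lambda>m. measure \<mu> (ball x0 (1 / Suc m) \<inter> space \<mu>)) \<longlonglongrightarrow>
      measure \<mu> (\<Inter>m. ball x0 (1 / Suc m) \<inter> space \<mu>)"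
  proof (rule finite_Lim_measure_decseq)
    show "decseq (\<lambda>m. ball x0 (1 / Suc m) \<inter> space \<mu>)"
      by (intro decseq_SucI Int_mono subset_ball) (auto intro!: divide_left_mono)
  qed (auto intro: borel_Int_sets_\<mu>)
  also have "(\<Inter>m. ball x0 (1 / Suc m) \<inter> space \<mu>) = {x0}"
  proof
    show "(\<Inter>m. ball x0 (1 / Suc m) \<inter> space \<mu>) \<subseteq> {x0}"
    proof
      fix y assume y: "y \<in> (\<Inter>m. ball x0 (1 / Suc m) \<inter> space \<mu>)"
      have "\<not> 0 < dist x0 y"
      proof
        assume "0 < dist x0 y"
        then obtain m where "inverse (real (Suc m)) < dist x0 y" using reals_Archimedean by blast
        then show False using y by (auto simp: inverse_eq_divide dest!: spec[of _ m])
      qed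
      then show "y \<in> {x0}" by simp
    qed
  qed (use assms in \<open>auto simp: space_\<mu>\<close>)
  finally have "\<forall>\<^sub>F m in sequentially. measure \<mu> (ball x0 (1 / Suc m) \<inter> space \<mu>) < measure \<mu> {x0} + \<eta>"
    using assms(2) by (intro order_tendstoD(2)) auto
  then obtain m where "measure \<mu> (ball x0 (1 / Suc m) \<inter> space \<mu>) < measure \<mu> {x0} + \<eta>"
    by (auto simp: eventually_sequentially)
  then show thesis by (intro that[of "1 / Suc m"]) auto
qed

lemma punctured_ball_mass:
  assumes "x0 \<in> \<Omega>" "0 < \<delta>"
  shows "measure \<mu> ((ball x0 \<delta> - {x0}) \<inter> space \<mu>) = measure \<mu> (ball x0 \<delta> \<inter> space \<mu>) - measure \<mu> {x0}"
proof -
  have "measure \<mu> (ball x0 \<delta> \<inter> space \<mu> - {x0} \<inter> space \<mu>)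
      = measure \<mu> (ball x0 \<delta> \<inter> space \<mu>) - measure \<mu> ({x0} \<inter> space \<mu>)"
    using assms by (intro finite_measure_Diff borel_Int_sets_\<mu>) auto
  moreover have "{x0} \<inter> space \<mu> = {x0}" using assms by (auto simp: space_\<mu>)
  ultimately show ?thesis by (simp add: Int_Diff Diff_Int_distrib2)
qed

text \<open>
The weights in view are \<open>\<rho> powr \<alpha>\<close> for \<open>p < n\<close> and \<open>1 / ln (1 / \<rho>)\<close> for \<open>p = n\<close>. The lower bound keeps only the point mass and \<open>t > \<rho>\<close>. For the upper bound
\<open>{0<..<r0}\<close> is cut at \<open>\<rho> / 16\<close>, \<open>\<rho>\<close> and a small fixed \<open>\<delta>\<close>: the first piece tends to 0 by assumption, the second is small because the
ball misses \<open>x0\<close>, the third carries mass at most \<open>a + \<eta>\<close> and yields the limit, and the last is bounded, so the weight kills it.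
\<close>

lemma weighted_wolff_potential_limit:
  fixes w :: "real \<Rightarrow> ennreal"
  assumes x0: "x0 \<in> \<Omega>" and p: "1 < p" "p \<le> real DIM('a)" and r0: "0 < r0" and \<kappa>: "0 \<le> \<kappa>"
  defines "\<alpha> \<equiv> (real DIM('a) - p) / (p - 1)"
  assumes w0: "(w \<longlongrightarrow> 0) (at_right 0)"
    and w_kernel: "\<And>\<delta>. 0 < \<delta> \<Longrightarrow>
      ((\<lambda>\<rho>. w \<rho> * (\<integral>\<^sup>+t\<in>{\<rho><..<\<delta>}. ennreal (t powr (- \<alpha> - 1)) \<partial>lborel)) \<longlongrightarrow> ennreal \<kappa>) (at_right 0)"
    and w_bound: "\<forall>\<^sub>F \<rho> in at_right 0. w \<rho> * ennreal (\<rho> powr (- \<alpha>)) \<le> 1"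
    and local: "((\<lambda>x. w (norm (x - x0)) * wolff_potential \<mu> p x (norm (x - x0) / 16)) \<longlongrightarrow> 0) (at x0 within S)"
  shows "((\<lambda>x. w (norm (x - x0)) * wolff_potential \<mu> p x r0) \<longlongrightarrow>
    ennreal (\<kappa> * measure \<mu> {x0} powr (1 / (p - 1)))) (at x0 within S)"
proof -
  let ?F = "at x0 within S" and ?q = "1 / (p - 1)" and ?a = "measure \<mu> {x0}"
  let ?\<rho> = "\<lambda>x. norm (x - x0)"
  define J where "J \<rho> \<delta> = (\<integral>\<^sup>+t\<in>{\<rho><..<\<delta>}. ennreal (t powr (- \<alpha> - 1)) \<partial>lborel)" for \<rho> \<delta> :: real
  have \<alpha>: "0 \<le> \<alpha>" using p by (simp add: \<alpha>_def)
  have q: "0 < ?q" using p by simp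
  have integrand: "wolff_integrand \<mu> p x t = measure \<mu> (ball x t \<inter> space \<mu>) powr ?q * t powr (- \<alpha> - 1)"
    if "0 < t" for x t unfolding \<alpha>_def by (rule wolff_integrand_eq[OF that])
  have pos: "\<forall>\<^sub>F x in ?F. 0 < ?\<rho> x \<and> ?\<rho> x < \<delta>" if "0 < \<delta>" for \<delta>
    using norm_diff_at_right[of x0 S] eventually_at_right_real[OF that]
    by (auto simp: filterlim_iff)
  have lim_J: "((\<lambda>x. w (?\<rho> x) * J (?\<rho> x) \<delta>) \<longlongrightarrow> ennreal \<kappa>) ?F" if "0 < \<delta>" for \<delta>
    using filterlim_compose[OF w_kernel[OF that] norm_diff_at_right] by (simp add: J_def)
  have lim_w: "((\<lambda>x. w (?\<rho> x)) \<longlongrightarrow> 0) ?F"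
    using filterlim_compose[OF w0 norm_diff_at_right] .
  have bound_w: "\<forall>\<^sub>F x in ?F. w (?\<rho> x) * ennreal (?\<rho> x powr (- \<alpha>)) \<le> 1"
    using norm_diff_at_right[of x0 S] w_bound by (auto simp: filterlim_iff)
  show ?thesis
  proof (rule order_tendstoI)
    fix y assume y: "y < ennreal (\<kappa> * ?a powr ?q)"
    have "((\<lambda>x. ennreal (?a powr ?q) * (w (?\<rho> x) * J (?\<rho> x) r0)) \<longlongrightarrow> ennreal (?a powr ?q) * ennreal \<kappa>) ?F"
      by (intro ennreal_tendsto_cmult lim_J r0) simp
    then have "\<forall>\<^sub>F x in ?F. y < ennreal (?a powr ?q) * (w (?\<rho> x) * J (?\<rho> x) r0)"
      using y \<kappa> by (intro order_tendstoD(1)) (auto simp: ennreal_mult[symmetric] mult.commute)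
    with pos[OF zero_less_one] show "\<forall>\<^sub>F x in ?F. y < w (?\<rho> x) * wolff_potential \<mu> p x r0"
    proof eventually_elim
      case (elim x)
      have "ennreal (?a powr ?q) * J (?\<rho> x) r0 =
        (\<integral>\<^sup>+t. ennreal (?a powr ?q) * (ennreal (t powr (- \<alpha> - 1)) * indicator {?\<rho> x<..<r0} t) \<partial>lborel)"
        unfolding J_def by (rule nn_integral_cmult[symmetric]) measurable
      also have "\<dots> \<le> wolff_potential \<mu> p x r0"
        unfolding wolff_potential_eq
      proof (rule nn_integral_mono)
        fix t
        show "ennreal (?a powr ?q) * (ennreal (t powr (- \<alpha> - 1)) * indicator {?\<rho> x<..<r0} t)
          \<le> ennreal (wolff_integrand \<mu> p x t) * indicator {0<..<r0} t"
        proof (cases "t \<in> {?\<rho> x<..<r0}")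
          case True
          then have "?\<rho> x < t" by simp
          moreover from this have "0 < t" using norm_ge_zero[of "x - x0"] by linarith
          ultimately have t: "0 < t" "?\<rho> x < t" by auto
          have "?a \<le> measure \<mu> (ball x t \<inter> space \<mu>)"
            using x0 t by (intro finite_measure_mono borel_Int_sets_\<mu>) (auto simp: dist_norm space_\<mu>)
          then have "?a powr ?q \<le> measure \<mu> (ball x t \<inter> space \<mu>) powr ?q"
            using q by (intro powr_mono2) auto
          then have "?a powr ?q * t powr (- \<alpha> - 1) \<le> wolff_integrand \<mu> p x t"
            unfolding integrand[OF t(1)] by (intro mult_right_mono) auto
          then show ?thesis using True t by (simp add: ennreal_leI flip: ennreal_mult)
        qed simp
      qed
      finally have "w (?\<rho> x) * (ennreal (?a powr ?q) * J (?\<rho> x) r0) \<le> w (?\<rho> x) * wolff_potential \<mu> p x r0"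
        by (rule mult_left_mono) simp
      then show ?case using elim by (simp add: ac_simps)
    qed
  next
    fix y assume y: "ennreal (\<kappa> * ?a powr ?q) < y"
    \<comment> \<open>The limit of the upper bound for fixed \<open>\<eta>\<close>, which in turn tends to the claimed limit.\<close>
    define H where "H \<eta> = 16 powr (\<alpha> + 1) * \<eta> powr ?q + (?a + \<eta>) powr ?q * \<kappa>" for \<eta>
    have "(H \<longlongrightarrow> 16 powr (\<alpha> + 1) * 0 powr ?q + (?a + 0) powr ?q * \<kappa>) (at_right 0)"
      unfolding H_def using q
      by (intro tendsto_intros tendsto_powr') (auto intro!: eventually_at_rightI[of 0 1] add_nonneg_nonneg)
    then have "((\<lambda>\<eta>. ennreal (H \<eta>)) \<longlongrightarrow> ennreal (\<kappa> * ?a powr ?q)) (at_right 0)"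
      using q by (intro tendsto_ennrealI) (simp add: mult.commute)
    then have "\<forall>\<^sub>F \<eta> in at_right 0. ennreal (H \<eta>) < y" using y by (rule order_tendstoD(2))
    with eventually_at_right_less[of 0] have "\<forall>\<^sub>F \<eta> in at_right 0. 0 < \<eta> \<and> ennreal (H \<eta>) < y"
      by eventually_elim simp
    then obtain \<eta> where \<eta>: "0 < \<eta>" "ennreal (H \<eta>) < y"
      using eventually_happens'[of "at_right (0::real)"] by (auto simp: trivial_limit_at_right_real)
    obtain \<delta>2 where \<delta>2: "0 < \<delta>2" "measure \<mu> (ball x0 \<delta>2 \<inter> space \<mu>) < ?a + \<eta>"
      using mass_near_point[OF x0 \<eta>(1)] by blast
    define \<delta> where "\<delta> = \<delta>2 / 2"
    have \<delta>: "0 < \<delta>" "measure \<mu> (ball x0 (2 * \<delta>) \<inter> space \<mu>) < ?a + \<eta>" using \<delta>2 by (auto simp: \<delta>_def)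
    define D where "D = measure \<mu> (space \<mu>) powr ?q * \<delta> powr (- \<alpha> - 1) * r0"
    have D: "0 \<le> D" using r0 by (simp add: D_def)
    let ?c = "16 powr (\<alpha> + 1) * \<eta> powr ?q"
    define U where "U x = w (?\<rho> x) * wolff_potential \<mu> p x (?\<rho> x / 16) + ennreal ?c
        + ennreal ((?a + \<eta>) powr ?q) * (w (?\<rho> x) * J (?\<rho> x) \<delta>) + ennreal D * w (?\<rho> x)" for x
    have "(U \<longlongrightarrow> 0 + ennreal ?c + ennreal ((?a + \<eta>) powr ?q) * ennreal \<kappa> + ennreal D * 0) ?F"
      unfolding U_def[abs_def]
      by (intro tendsto_add local tendsto_const ennreal_tendsto_cmult lim_J lim_w \<delta>) auto
    also have "0 + ennreal ?c + ennreal ((?a + \<eta>) powr ?q) * ennreal \<kappa> + ennreal D * 0 = ennreal (H \<eta>)"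
      using \<kappa> by (simp add: H_def ennreal_mult)
    finally have "\<forall>\<^sub>F x in ?F. U x < y" using \<eta>(2) by (rule order_tendstoD(2))
    with pos[OF \<delta>(1)] bound_w show "\<forall>\<^sub>F x in ?F. w (?\<rho> x) * wolff_potential \<mu> p x r0 < y"
    proof eventually_elim
      case (elim x)
      let ?r = "?\<rho> x"
      have r: "0 < ?r" "?r < \<delta>" using elim by auto
      let ?f1 = "\<lambda>t. ennreal (wolff_integrand \<mu> p x t) * indicator {0<..<?r / 16} t"
      let ?f2 = "\<lambda>t. ennreal (\<eta> powr ?q * (?r / 16) powr (- \<alpha> - 1)) * indicator {?r / 16..?r} t"
      let ?f3 = "\<lambda>t. ennreal ((?a + \<eta>) powr ?q) * (ennreal (t powr (- \<alpha> - 1)) * indicator {?r<..<\<delta>} t)"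
      let ?f4 = "\<lambda>t. ennreal (measure \<mu> (space \<mu>) powr ?q * \<delta> powr (- \<alpha> - 1)) * indicator {0..r0} t"
      have "wolff_potential \<mu> p x r0 \<le> (\<integral>\<^sup>+t. ?f1 t + ?f2 t + ?f3 t + ?f4 t \<partial>lborel)"
        unfolding wolff_potential_eq
      proof (rule nn_integral_mono)
        fix t
        show "ennreal (wolff_integrand \<mu> p x t) * indicator {0<..<r0} t \<le> ?f1 t + ?f2 t + ?f3 t + ?f4 t"
        proof (cases "t \<in> {0<..<r0}")
          case True
          then have t: "0 < t" "t < r0" by auto
          consider "t < ?r / 16" | "?r / 16 \<le> t" "t \<le> ?r" | "?r < t" "t < \<delta>" | "\<delta> \<le> t" by linarith
          then show ?thesis
          proof cases
            case 1
            then have "?f1 t = ennreal (wolff_integrand \<mu> p x t)" using t by simp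
            then show ?thesis using True by (simp add: add_increasing2 add.assoc)
          next
            case 2
            have "measure \<mu> (ball x t \<inter> space \<mu>) \<le> measure \<mu> ((ball x0 (2 * \<delta>) - {x0}) \<inter> space \<mu>)"
            proof (rule measure_Int_mono)
              show "ball x t \<subseteq> ball x0 (2 * \<delta>) - {x0}"
              proof
                fix z assume z: "z \<in> ball x t"
                then have "dist x0 z < 2 * \<delta>"
                  using 2 r dist_triangle[of x0 z x] by (simp add: dist_norm norm_minus_commute)
                moreover have "z \<noteq> x0" using z 2 by (auto simp: dist_norm)
                ultimately show "z \<in> ball x0 (2 * \<delta>) - {x0}" by simp
              qed
            qed auto
            also have "\<dots> \<le> \<eta>" using punctured_ball_mass[OF x0, of "2 * \<delta>"] \<delta> by simp
            finally have "measure \<mu> (ball x t \<inter> space \<mu>) powr ?q * t powr (- \<alpha> - 1)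
                \<le> \<eta> powr ?q * (?r / 16) powr (- \<alpha> - 1)"
              using q r 2 \<alpha> by (intro mult_mono powr_mono2 powr_mono2') auto
            then have "ennreal (wolff_integrand \<mu> p x t) \<le> ?f2 t"
              unfolding integrand[OF t(1)] using 2 by (simp add: ennreal_leI)
            then show ?thesis using True by (simp add: add_increasing add_increasing2)
          next
            case 3
            have "measure \<mu> (ball x t \<inter> space \<mu>) \<le> measure \<mu> (ball x0 (2 * \<delta>) \<inter> space \<mu>)"
            proof (rule measure_Int_mono)
              show "ball x t \<subseteq> ball x0 (2 * \<delta>)"
              proof
                fix z assume z: "z \<in> ball x t"
                then show "z \<in> ball x0 (2 * \<delta>)"
                  using 3 r dist_triangle[of x0 z x] by (simp add: dist_norm norm_minus_commute)
              qed
            qed auto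
            also have "\<dots> \<le> ?a + \<eta>" using \<delta> by simp
            finally have "measure \<mu> (ball x t \<inter> space \<mu>) powr ?q * t powr (- \<alpha> - 1)
                \<le> (?a + \<eta>) powr ?q * t powr (- \<alpha> - 1)"
              using q by (intro mult_right_mono powr_mono2) auto
            then have "ennreal (wolff_integrand \<mu> p x t) \<le> ?f3 t"
              unfolding integrand[OF t(1)] using 3 by (simp add: ennreal_leI flip: ennreal_mult)
            then show ?thesis using True by (simp add: add_increasing add_increasing2)
          next
            case 4
            have "measure \<mu> (ball x t \<inter> space \<mu>) powr ?q * t powr (- \<alpha> - 1)
                \<le> measure \<mu> (space \<mu>) powr ?q * \<delta> powr (- \<alpha> - 1)"
              using q 4 \<delta> \<alpha> t by (intro mult_mono powr_mono2 powr_mono2' finite_measure_mono) auto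
            then have "ennreal (wolff_integrand \<mu> p x t) \<le> ?f4 t"
              unfolding integrand[OF t(1)] using 4 t by (simp add: ennreal_leI)
            then show ?thesis using True by (simp add: add_increasing)
          qed
        qed simp
      qed
      also have "\<dots> = (\<integral>\<^sup>+t. ?f1 t \<partial>lborel) + (\<integral>\<^sup>+t. ?f2 t \<partial>lborel) + (\<integral>\<^sup>+t. ?f3 t \<partial>lborel) + (\<integral>\<^sup>+t. ?f4 t \<partial>lborel)"
        by (simp add: nn_integral_add)
      also have "(\<integral>\<^sup>+t. ?f1 t \<partial>lborel) = wolff_potential \<mu> p x (?r / 16)"
        by (rule wolff_potential_eq[symmetric])
      also have "(\<integral>\<^sup>+t. ?f3 t \<partial>lborel) = ennreal ((?a + \<eta>) powr ?q) * J ?r \<delta>"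
        unfolding J_def by (rule nn_integral_cmult) measurable
      also have "(\<integral>\<^sup>+t. ?f4 t \<partial>lborel) = ennreal D"
        using r0 by (subst nn_integral_cmult_indicator) (auto simp: D_def ennreal_mult)
      also have "(\<integral>\<^sup>+t. ?f2 t \<partial>lborel) \<le> ennreal ?c * ennreal (?r powr (- \<alpha>))"
      proof -
        have "(\<integral>\<^sup>+t. ?f2 t \<partial>lborel) = ennreal (\<eta> powr ?q * (?r / 16) powr (- \<alpha> - 1) * (?r - ?r / 16))"
          using r by (subst nn_integral_cmult_indicator) (auto simp flip: ennreal_mult')
        also have "\<dots> \<le> ennreal (\<eta> powr ?q * (?r / 16) powr (- \<alpha> - 1) * ?r)"
          using r by (intro ennreal_leI mult_left_mono) auto
        also have "\<eta> powr ?q * (?r / 16) powr (- \<alpha> - 1) * ?r = ?c * ?r powr (- \<alpha>)"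
          using r by (simp add: powr_divide powr_diff powr_add powr_minus field_simps)
        finally show ?thesis by (simp add: ennreal_mult)
      qed
      finally have "wolff_potential \<mu> p x r0 \<le> wolff_potential \<mu> p x (?r / 16) + ennreal ?c * ennreal (?r powr (- \<alpha>))
          + ennreal ((?a + \<eta>) powr ?q) * J ?r \<delta> + ennreal D" by (simp add: add_mono)
      then have "w ?r * wolff_potential \<mu> p x r0 \<le> w ?r * (wolff_potential \<mu> p x (?r / 16) + ennreal ?c * ennreal (?r powr (- \<alpha>))
          + ennreal ((?a + \<eta>) powr ?q) * J ?r \<delta> + ennreal D)" by (rule mult_left_mono) simp
      also have "\<dots> = w ?r * wolff_potential \<mu> p x (?r / 16) + ennreal ?c * (w ?r * ennreal (?r powr (- \<alpha>)))
          + ennreal ((?a + \<eta>) powr ?q) * (w ?r * J ?r \<delta>) + ennreal D * w ?r"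
        by (simp add: distrib_left ac_simps)
      also have "\<dots> \<le> w ?r * wolff_potential \<mu> p x (?r / 16) + ennreal ?c * 1
          + ennreal ((?a + \<eta>) powr ?q) * (w ?r * J ?r \<delta>) + ennreal D * w ?r"
        using elim by (intro add_mono mult_left_mono) auto
      also have "\<dots> = U x" by (simp add: U_def)
      also have "\<dots> < y" using elim by simp
      finally show ?case .
    qed
  qed
qed

section \<open>The exceptional set\<close>

text \<open>
The part of \<open>\<mu>\<close> in \<open>A\<close> as a Borel measure on the whole space, the kind of measure that the weak type estimate is about.
\<close>

definition localized_measure :: "'a set \<Rightarrow> 'a measure" where
  "localized_measure A = distr (restrict_space \<mu> (A \<inter> space \<mu>)) borel (\<lambda>x. x)"

lemma localized_measure:
  assumes A: "A \<in> sets borel"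
  shows "sets (localized_measure A) = sets borel" "finite_measure (localized_measure A)"
    "B \<in> sets borel \<Longrightarrow> measure (localized_measure A) B = measure \<mu> (A \<inter> B \<inter> space \<mu>)"
proof -
  have A': "A \<inter> space \<mu> \<in> sets \<mu>" using A by (rule borel_Int_sets_\<mu>)
  have "(\<lambda>x. x) \<in> measurable \<mu> borel"
  proof (rule measurableI)
    show "(\<lambda>x. x) -` B \<inter> space \<mu> \<in> sets \<mu>" if "B \<in> sets borel" for B :: "'a set"
      using borel_Int_sets_\<mu>[OF that] by simp
  qed simp
  then have meas: "(\<lambda>x. x) \<in> measurable (restrict_space \<mu> (A \<inter> space \<mu>)) borel"
    by (rule measurable_restrict_space1)
  show "sets (localized_measure A) = sets borel" by (simp add: localized_measure_def)
  have emeasure: "emeasure (localized_measure A) B = emeasure \<mu> (A \<inter> B \<inter> space \<mu>)" if B: "B \<in> sets borel" for B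
  proof -
    have "emeasure (localized_measure A) B = emeasure (restrict_space \<mu> (A \<inter> space \<mu>)) (B \<inter> (A \<inter> space \<mu>))"
      unfolding localized_measure_def using A'
      by (subst emeasure_distr[OF meas B]) (simp add: space_restrict_space)
    also have "\<dots> = emeasure \<mu> (B \<inter> (A \<inter> space \<mu>))"
      using A' by (intro emeasure_restrict_space) auto
    finally show ?thesis by (simp add: ac_simps)
  qed
  show "B \<in> sets borel \<Longrightarrow> measure (localized_measure A) B = measure \<mu> (A \<inter> B \<inter> space \<mu>)"
    by (simp add: measure_def emeasure)
  show "finite_measure (localized_measure A)"
    using emeasure[of UNIV] sets_eq_imp_space_eq[of "localized_measure A" borel]
    by (intro finite_measureI) (simp add: localized_measure_def emeasure_eq_measure)
qed

text \<open>
For \<open>r / 2 \<le> t < r\<close> the integrand is at most its numerator at \<open>r\<close> over its denominator at \<open>r / 2\<close>, and the interval has length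
\<open>r / 2\<close>; so the dyadic sums control the integral.
\<close>

lemma wolff_potential_le_dyadic:
  assumes p: "1 < p" "p \<le> real DIM('a)" and R: "0 < R"
    and \<nu>: "\<And>r. r \<le> R \<Longrightarrow> measure \<nu> (ball x r) = measure \<mu> (ball x r \<inter> space \<mu>)"
    and bound: "\<And>N. dyadic_potential \<nu> p R N x \<le> \<theta>"
  shows "wolff_potential \<mu> p x R \<le> ennreal (2 powr ((real DIM('a) - p) / (p - 1)) * \<theta>)"
proof -
  let ?d = "real DIM('a) - p" and ?r = "\<lambda>k. R / 2 ^ k" and ?c = "2 powr ((real DIM('a) - p) / (p - 1))"
  let ?h = "\<lambda>k. ?c * dyadic_term \<nu> p R k x / ?r (Suc k)"
  have rpos: "?r k > 0" for k using R by simp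
  have h: "0 \<le> ?h k" for k using rpos[of "Suc k"] by (intro divide_nonneg_pos mult_nonneg_nonneg dyadic_term_nonneg) auto
  have integrand: "wolff_integrand \<mu> p x t \<le> ?h k" if t: "?r (Suc k) \<le> t" "t < ?r k" for t k
  proof -
    have tpos: "0 < t" using t rpos[of "Suc k"] by linarith
    have "?r k \<le> R" using R by (simp add: divide_le_eq)
    then have "measure \<mu> (ball x t \<inter> space \<mu>) \<le> measure \<nu> (ball x (?r k))"
      using t by (subst \<nu>) (auto intro!: finite_measure_mono borel_Int_sets_\<mu>)
    then have "wolff_integrand \<mu> p x t \<le> (measure \<nu> (ball x (?r k)) / ?r (Suc k) powr ?d) powr (1 / (p - 1)) / ?r (Suc k)"
      unfolding wolff_integrand_def using p t tpos rpos[of "Suc k"]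
      by (intro frac_le powr_mono2) (auto intro!: powr_mono2)
    also have "measure \<nu> (ball x (?r k)) / ?r (Suc k) powr ?d = 2 powr ?d * (measure \<nu> (ball x (?r k)) / ?r k powr ?d)"
    proof -
      have "?r k powr ?d = (2 * ?r (Suc k)) powr ?d" by simp
      also have "\<dots> = 2 powr ?d * ?r (Suc k) powr ?d" by (rule powr_mult)
      finally show ?thesis by simp
    qed
    also have "\<dots> powr (1 / (p - 1)) = ?c * dyadic_term \<nu> p R k x"
      unfolding dyadic_term_def by (subst powr_mult) (simp add: powr_powr)
    finally show ?thesis .
  qed
  have "wolff_potential \<mu> p x R \<le> (\<integral>\<^sup>+t. (\<Sum>k. ennreal (?h k) * indicator {?r (Suc k)..<?r k} t) \<partial>lborel)"
    unfolding wolff_potential_eq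
  proof (rule nn_integral_mono)
    fix t
    show "ennreal (wolff_integrand \<mu> p x t) * indicator {0<..<R} t \<le> (\<Sum>k. ennreal (?h k) * indicator {?r (Suc k)..<?r k} t)"
    proof (cases "t \<in> {0<..<R}")
      case True
      then have "\<exists>n. (1 / 2) ^ n < t / R" using R by (intro real_arch_pow_inv) auto
      then have ex: "\<exists>n. ?r n \<le> t" using R by (auto simp: field_simps power_divide intro: less_imp_le)
      define n where "n = (LEAST n. ?r n \<le> t)"
      have n: "?r n \<le> t" unfolding n_def by (rule LeastI_ex[OF ex])
      then have "n \<noteq> 0" using True by (cases n) auto
      then obtain k where k: "n = Suc k" by (cases n) auto
      have "t < ?r k" using not_less_Least[of k "\<lambda>n. ?r n \<le> t"] k unfolding n_def by auto
      then have tk: "t \<in> {?r (Suc k)..<?r k}" using n k by auto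
      have "ennreal (wolff_integrand \<mu> p x t) \<le> ennreal (?h k) * indicator {?r (Suc k)..<?r k} t"
        using tk integrand[of k t] by (simp only: indicator_simps mult_1_right) (intro ennreal_leI, simp)
      also have "\<dots> \<le> (\<Sum>k. ennreal (?h k) * indicator {?r (Suc k)..<?r k} t)"
      proof -
        have "f k \<le> suminf f" for f :: "nat \<Rightarrow> ennreal"
          using sum_le_suminf[of f "{k}"] by (simp add: summableI)
        then show ?thesis .
      qed
      finally show ?thesis using True by simp
    qed simp
  qed
  also have "\<dots> = (\<Sum>k. \<integral>\<^sup>+t. ennreal (?h k) * indicator {?r (Suc k)..<?r k} t \<partial>lborel)"
    by (rule nn_integral_suminf) simp
  also have "\<dots> = (\<Sum>k. ennreal (?c * dyadic_term \<nu> p R k x))"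
  proof (rule suminf_cong)
    fix k
    have "(\<integral>\<^sup>+t. ennreal (?h k) * indicator {?r (Suc k)..<?r k} t \<partial>lborel) = ennreal (?h k) * ennreal (?r k - ?r (Suc k))"
      using R by (subst nn_integral_cmult_indicator) (auto simp: field_simps)
    also have "\<dots> = ennreal (?h k * ?r (Suc k))"
      using h[of k] by (simp flip: ennreal_mult')
    also have "?h k * ?r (Suc k) = ?c * dyadic_term \<nu> p R k x" using R by simp
    finally show "(\<integral>\<^sup>+t. ennreal (?h k) * indicator {?r (Suc k)..<?r k} t \<partial>lborel) = ennreal (?c * dyadic_term \<nu> p R k x)" .
  qed
  also have "\<dots> \<le> ennreal (?c * \<theta>)"
  proof (rule suminf_le_const[OF summableI])
    fix N
    have "(\<Sum>k<N. ennreal (?c * dyadic_term \<nu> p R k x)) = ennreal (?c * dyadic_potential \<nu> p R N x)"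
      by (subst sum_ennreal) (auto simp: dyadic_term_nonneg dyadic_potential_def sum_distrib_left)
    also have "\<dots> \<le> ennreal (?c * \<theta>)" using bound[of N] by (intro ennreal_leI mult_left_mono) auto
    finally show "(\<Sum>k<N. ennreal (?c * dyadic_term \<nu> p R k x)) \<le> ennreal (?c * \<theta>)" .
  qed
  finally show ?thesis .
qed

text \<open>
With \<open>\<beta>\<^sub>i\<close> the mass of the ball of radius \<open>2 (1/2)^i\<close>, the inner radius of the annulus is that of the ball three steps later. So
its mass is at most \<open>\<beta>\<^sub>i - \<beta>\<^sub>i\<^sub>+\<^sub>3\<close>, three consecutive differences of a convergent sequence.
\<close>

lemma annulus_mass_summable: "summable (\<lambda>i. measure \<mu> (annulus x0 i \<inter> space \<mu>))"
proof -
  define \<beta> where "\<beta> i = measure \<mu> (ball x0 (2 * (1 / 2) ^ i) \<inter> space \<mu>)" for i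
  have "decseq \<beta>"
    unfolding \<beta>_def by (intro decseq_SucI finite_measure_mono borel_Int_sets_\<mu> Int_mono subset_ball) auto
  moreover have "\<forall>i. 0 \<le> \<beta> i" by (simp add: \<beta>_def)
  ultimately obtain L where L: "\<beta> \<longlonglongrightarrow> L" by (rule decseq_convergent)
  have s: "summable (\<lambda>i. \<beta> (i + k) - \<beta> (Suc (i + k)))" for k
    using telescope_summable'[OF L] by (subst summable_iff_shift)
  have "summable (\<lambda>i. (\<beta> (i + 0) - \<beta> (Suc (i + 0))) + (\<beta> (i + 1) - \<beta> (Suc (i + 1))) + (\<beta> (i + 2) - \<beta> (Suc (i + 2))))"
    by (intro summable_add s)
  then have sum: "summable (\<lambda>i. \<beta> i - \<beta> (i + 3))" by (simp add: numeral_3_eq_3)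
  show ?thesis
  proof (rule summable_comparison_test'[OF sum, where N = 0])
    fix i
    let ?B = "ball x0 (2 * (1 / 2) ^ i) \<inter> space \<mu>" and ?C = "ball x0 (2 * (1 / 2) ^ (i + 3)) \<inter> space \<mu>"
    have eighth: "2 * (1 / 2 :: real) ^ (i + 3) = (1 / 2) ^ i / 4"
      by (simp add: power_add eval_nat_numeral)
    have "measure \<mu> (annulus x0 i \<inter> space \<mu>) \<le> measure \<mu> (?B - ?C)"
      unfolding eighth
      by (intro finite_measure_mono sets.Diff borel_Int_sets_\<mu>)
        (auto simp: annulus_def dist_norm norm_minus_commute)
    also have "\<dots> = \<beta> i - \<beta> (i + 3)"
      unfolding \<beta>_def
    proof (intro finite_measure_Diff borel_Int_sets_\<mu>)
      have "(1 / 2 :: real) ^ (i + 3) \<le> (1 / 2) ^ i" by (intro power_decreasing) auto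
      then show "?C \<subseteq> ?B" by (intro Int_mono subset_ball) auto
    qed auto
    finally show "norm (measure \<mu> (annulus x0 i \<inter> space \<mu>)) \<le> \<beta> i - \<beta> (i + 3)" by simp
  qed
qed

text \<open>
The sequence \<open>\<Lambda>\<close> is the growth allowed on the \<open>i\<close>-th shell; the last conclusion holds for every weight that compensates it.
The bounds \<open>s\<close> are the annulus masses times weights tending to infinity, and these weights are what turns boundedness of
the weighted local potential into convergence to 0.
\<close>

lemma exceptional_set_exists:
  fixes \<Lambda> :: "nat \<Rightarrow> real"
  assumes p: "1 < p" "p \<le> real DIM('a)" and \<Lambda>: "\<And>i. 0 < i \<Longrightarrow> 0 < \<Lambda> i"
  obtains E s where "summable s" "\<And>i. 0 \<le> s i"
    "\<And>i. 0 < i \<Longrightarrow> cap p (E \<inter> shell i x0) (interior (wide_shell i x0)) \<le> ennreal (s i / \<Lambda> i powr (p - 1))"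
    "\<And>(w :: real \<Rightarrow> ennreal) B. (\<And>i \<rho>. 0 < i \<Longrightarrow> 0 < \<rho> \<Longrightarrow> \<rho> \<le> (1 / 2) ^ i \<Longrightarrow> w \<rho> * ennreal (\<Lambda> i) \<le> ennreal B) \<Longrightarrow>
      ((\<lambda>x. w (norm (x - x0)) * wolff_potential \<mu> p x (norm (x - x0) / 16)) \<longlongrightarrow> 0) (at x0 within - E)"
proof -
  obtain C where C: "C > 0" and cap_bound:
    "\<And>(\<nu> :: 'a measure) R \<theta> U V E.
      \<lbrakk>sets \<nu> = sets borel; finite_measure \<nu>; 0 < R; 0 < \<theta>; open V;
       \<And>x. x \<in> V \<Longrightarrow> cball x R \<subseteq> U;
       E \<subseteq> {x \<in> V. \<exists>N. \<theta> < dyadic_potential \<nu> p R N x}\<rbrakk>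
      \<Longrightarrow> cap p E U \<le> ennreal (C * measure \<nu> UNIV / \<theta> powr (p - 1))"
    by (erule cap_superlevel_bound[OF p(1), where ?'a = 'a])
  define m where "m i = measure \<mu> (annulus x0 i \<inter> space \<mu>)" for i
  obtain d where d: "\<And>i. 0 < d i" "filterlim d at_top sequentially" "summable (\<lambda>i. m i * d i)"
    using summable_with_unbounded_weights[OF annulus_mass_summable[of x0]] unfolding m_def
    by (metis measure_nonneg)
  let ?q = "1 / (p - 1)"
  define \<nu> where "\<nu> i = localized_measure (annulus x0 i)" for i
  define R where "R i = (1 / 2 :: real) ^ i / 16" for i
  define \<theta> where "\<theta> i = \<Lambda> i * d i powr (- ?q)" for i
  \<comment> \<open>Consecutive shells share a sphere. Demanding a large potential for every shell containing \<open>x\<close>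
    makes \<open>E \<inter> shell i x0\<close> a subset of a single superlevel set, while a point outside \<open>E\<close> still has
    a small potential with respect to one of its shells.\<close>
  define E where "E = {x. \<forall>i. x \<in> shell i x0 \<longrightarrow> (\<exists>N. \<theta> i < dyadic_potential (\<nu> i) p (R i) N x)}"
  \<comment> \<open>An open neighbourhood of the shell from which balls of radius \<open>R i\<close> stay in the annulus.\<close>
  define V where "V i = {x::'a. 3 / 8 * (1 / 2) ^ i < norm (x - x0) \<and> norm (x - x0) < 5 / 4 * (1 / 2) ^ i}" for i
  note \<nu> = localized_measure[OF borel_open[OF open_annulus[of x0]], folded \<nu>_def]
  have R: "0 < R i" for i by (simp add: R_def)
  have V: "open (V i)" for i
    unfolding V_def by (intro open_Collect_conj open_Collect_less continuous_intros)
  have shell_V: "shell i x0 \<subseteq> V i" for i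
  proof
    fix x assume "x \<in> shell i x0"
    then have "(1 / 2) ^ i / 2 \<le> norm (x - x0)" "norm (x - x0) \<le> (1 / 2) ^ i"
      by (auto simp: shell_def powi_half powi_half_shifts)
    moreover have "(1 / 2 :: real) ^ i > 0" by simp
    ultimately show "x \<in> V i" unfolding V_def mem_Collect_eq by linarith
  qed
  have V_annulus: "cball x (R i) \<subseteq> annulus x0 i" if "x \<in> V i" for x i
  proof
    fix z assume z: "z \<in> cball x (R i)"
    have "\<bar>norm (z - x0) - norm (x - x0)\<bar> \<le> norm (z - x)"
      using norm_triangle_ineq3[of "z - x0" "x - x0"] by simp
    also have "\<dots> \<le> (1 / 2) ^ i / 16" using z by (simp add: dist_norm norm_minus_commute R_def)
    finally have "\<bar>norm (z - x0) - norm (x - x0)\<bar> \<le> (1 / 2) ^ i / 16" .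
    moreover have "3 / 8 * (1 / 2) ^ i < norm (x - x0)" "norm (x - x0) < 5 / 4 * (1 / 2) ^ i"
      using that by (auto simp: V_def)
    moreover have "(1 / 2 :: real) ^ i > 0" by simp
    ultimately show "z \<in> annulus x0 i" unfolding annulus_def mem_Collect_eq by linarith
  qed
  show thesis
  proof (rule that)
    show "summable (\<lambda>i. C * (m i * d i))" using d(3) by (rule summable_mult)
    show "0 \<le> C * (m i * d i)" for i using C d(1)[of i] by (simp add: m_def)
    show "cap p (E \<inter> shell i x0) (interior (wide_shell i x0)) \<le> ennreal (C * (m i * d i) / \<Lambda> i powr (p - 1))"
      if i: "0 < i" for i
    proof -
      have "cap p (E \<inter> shell i x0) (interior (wide_shell i x0))
          \<le> ennreal (C * measure (\<nu> i) UNIV / \<theta> i powr (p - 1))"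
      proof (rule cap_bound[OF \<nu>(1,2) R _ V])
        show "0 < \<theta> i" using \<Lambda>[OF i] d(1)[of i] by (simp add: \<theta>_def)
        show "cball x (R i) \<subseteq> interior (wide_shell i x0)" if "x \<in> V i" for x
          using V_annulus[OF that] annulus_subset_wide_shell by blast
        show "E \<inter> shell i x0 \<subseteq> {x \<in> V i. \<exists>N. \<theta> i < dyadic_potential (\<nu> i) p (R i) N x}"
          using shell_V by (auto simp: E_def)
      qed
      also have "measure (\<nu> i) UNIV = m i" by (simp add: \<nu>(3) m_def)
      also have "C * m i / \<theta> i powr (p - 1) = C * (m i * d i) / \<Lambda> i powr (p - 1)"
      proof -
        have "- ?q * (p - 1) = - 1" using p by simp
        then have "\<theta> i powr (p - 1) = \<Lambda> i powr (p - 1) * d i powr (- 1)"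
          unfolding \<theta>_def by (simp only: powr_mult powr_powr)
        then have "\<theta> i powr (p - 1) = \<Lambda> i powr (p - 1) / d i"
          using d(1)[of i] by (simp add: powr_minus divide_inverse)
        then show ?thesis by simp
      qed
      finally show ?thesis .
    qed
    show "((\<lambda>x. w (norm (x - x0)) * wolff_potential \<mu> p x (norm (x - x0) / 16)) \<longlongrightarrow> 0) (at x0 within - E)"
      if w: "\<And>i \<rho>. 0 < i \<Longrightarrow> 0 < \<rho> \<Longrightarrow> \<rho> \<le> (1 / 2) ^ i \<Longrightarrow> w \<rho> * ennreal (\<Lambda> i) \<le> ennreal B"
      for w :: "real \<Rightarrow> ennreal" and B
    proof (rule order_tendstoI)
      fix y :: ennreal assume y: "0 < y"
      let ?c = "2 powr ((real DIM('a) - p) / (p - 1))"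
      have "(\<lambda>i. d i powr (- ?q)) \<longlonglongrightarrow> 0" using p by (intro tendsto_neg_powr d(2)) auto
      then have "(\<lambda>i. ennreal (d i powr (- ?q))) \<longlonglongrightarrow> ennreal 0" by (rule tendsto_ennrealI)
      then have "(\<lambda>i. ennreal B * ennreal ?c * ennreal (d i powr (- ?q))) \<longlonglongrightarrow> ennreal B * ennreal ?c * ennreal 0"
        by (intro ennreal_tendsto_cmult) (auto simp: ennreal_mult_less_top)
      then have "\<forall>\<^sub>F i in sequentially. ennreal B * ennreal ?c * ennreal (d i powr (- ?q)) < y"
        using y by (intro order_tendstoD(2)) auto
      then obtain I where I: "\<And>i. I \<le> i \<Longrightarrow> ennreal B * ennreal ?c * ennreal (d i powr (- ?q)) < y"
        by (auto simp: eventually_sequentially)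
      show "\<forall>\<^sub>F x in at x0 within - E. w (norm (x - x0)) * wolff_potential \<mu> p x (norm (x - x0) / 16) < y"
        unfolding eventually_at
      proof (intro exI[of _ "(1 / 2) ^ (Suc I)"] conjI ballI impI)
        fix x assume x: "x \<in> - E" "x \<noteq> x0 \<and> dist x x0 < (1 / 2) ^ (Suc I)"
        then obtain i where i: "x \<in> shell i x0" "\<And>N. dyadic_potential (\<nu> i) p (R i) N x \<le> \<theta> i"
          by (auto simp: E_def not_less)
        let ?\<rho> = "norm (x - x0)"
        have \<rho>: "0 < ?\<rho>" "(1 / 2) ^ i / 2 \<le> ?\<rho>" "?\<rho> \<le> (1 / 2) ^ i"
          using i(1) x by (auto simp: shell_def powi_half powi_half_shifts)
        have "?\<rho> < 1 / 2 * (1 / 2) ^ I" using x(2) by (simp add: dist_norm)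
        then have "(1 / 2 :: real) ^ i < (1 / 2) ^ I" using \<rho>(2) by linarith
        then have iI: "I < i" using power_decreasing[of i I "1 / 2 :: real"] by (cases "i \<le> I") auto
        have "wolff_potential \<mu> p x (?\<rho> / 16) \<le> wolff_potential \<mu> p x (R i)"
          unfolding wolff_potential_def using \<rho> by (intro nn_integral_mono) (auto simp: indicator_def R_def)
        also have "\<dots> \<le> ennreal (?c * \<theta> i)"
        proof (rule wolff_potential_le_dyadic[OF p R _ i(2)])
          fix r assume r: "r \<le> R i"
          have "ball x r \<subseteq> annulus x0 i"
            using V_annulus[of x i] shell_V[of i] i(1) r by force
          then show "measure (\<nu> i) (ball x r) = measure \<mu> (ball x r \<inter> space \<mu>)"
            by (simp add: \<nu>(3) Int_absorb1)
        qed
        finally have "w ?\<rho> * wolff_potential \<mu> p x (?\<rho> / 16) \<le> w ?\<rho> * ennreal (?c * \<theta> i)"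
          by (rule mult_left_mono) simp
        also have "\<dots> = (w ?\<rho> * ennreal (\<Lambda> i)) * ennreal ?c * ennreal (d i powr (- ?q))"
          using \<Lambda>[of i] iI by (simp add: \<theta>_def ennreal_mult ac_simps)
        also have "\<dots> \<le> ennreal B * ennreal ?c * ennreal (d i powr (- ?q))"
          using w[of i ?\<rho>] iI \<rho> by (intro mult_right_mono) auto
        also have "\<dots> < y" using I[of i] iI by simp
        finally show "w ?\<rho> * wolff_potential \<mu> p x (?\<rho> / 16) < y" .
      qed simp
    qed simp
  qed
qed

end

section \<open>Limits of the Wolff potential outside a thin set\<close>

theorem theorem1:
  fixes \<Omega> :: "'a::euclidean_space set" and \<mu> :: "'a measure" and x0 :: 'a and r0 :: real
  assumes "DIM('a) \<ge> 2"
    and "open \<Omega>" and "connected \<Omega>"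
    and "radon_measure_on \<Omega> \<mu>" and "finite_measure \<mu>"
    and "x0 \<in> \<Omega>" and "r0 > 0" and "ball x0 (3 * r0) \<subseteq> \<Omega>"
  shows "(\<forall>p::real. 1 < p \<and> p < real DIM('a) \<longrightarrow>
            (\<exists>E. p_thin p E x0 \<and>
              ((\<lambda>x. ennreal (norm (x - x0) powr ((real DIM('a) - p) / (p - 1))) *
                     wolff_potential \<mu> p x r0)
                \<longlongrightarrow> ennreal ((p - 1) / (real DIM('a) - p) * measure \<mu> {x0} powr (1 / (p - 1))))
              (at x0 within - E)))
       \<and> (\<exists>E. n_thin E x0 \<and>
              ((\<lambda>x. wolff_potential \<mu> (real DIM('a)) x r0 / ennreal (ln (1 / norm (x - x0))))
                \<longlongrightarrow> ennreal (measure \<mu> {x0} powr (1 / (real DIM('a) - 1))))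
              (at x0 within - E))"
proof -
  have sets_\<mu>: "sets \<mu> = sets (restrict_space borel \<Omega>)"
    using assms(4) by (simp add: radon_measure_on_def)
  note ctx = sets_\<mu> assms(5)
  let ?n = "real DIM('a)"
  have "\<exists>E. p_thin p E x0 \<and>
      ((\<lambda>x. ennreal (norm (x - x0) powr ((?n - p) / (p - 1))) * wolff_potential \<mu> p x r0)
        \<longlongrightarrow> ennreal ((p - 1) / (?n - p) * measure \<mu> {x0} powr (1 / (p - 1)))) (at x0 within - E)"
    if p: "1 < p" "p < ?n" for p
  proof -
    define \<alpha> where "\<alpha> = (?n - p) / (p - 1)"
    have \<alpha>: "0 < \<alpha>" "\<alpha> * (p - 1) = ?n - p" "1 / \<alpha> = (p - 1) / (?n - p)" using p by (auto simp: \<alpha>_def)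
    define \<Lambda> where "\<Lambda> i = ((1 / 2) ^ i) powr (- \<alpha>)" for i :: nat
    have \<Lambda>: "0 < \<Lambda> i" for i by (simp add: \<Lambda>_def)
    obtain E s where s: "summable s" "\<And>i. 0 \<le> s i"
      and cap_E: "\<And>i. 0 < i \<Longrightarrow> cap p (E \<inter> shell i x0) (interior (wide_shell i x0)) \<le> ennreal (s i / \<Lambda> i powr (p - 1))"
      and local: "\<And>(w :: real \<Rightarrow> ennreal) B.
        (\<And>i \<rho>. 0 < i \<Longrightarrow> 0 < \<rho> \<Longrightarrow> \<rho> \<le> (1 / 2) ^ i \<Longrightarrow> w \<rho> * ennreal (\<Lambda> i) \<le> ennreal B) \<Longrightarrow>
        ((\<lambda>x. w (norm (x - x0)) * wolff_potential \<mu> p x (norm (x - x0) / 16)) \<longlongrightarrow> 0) (at x0 within - E)"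
      using p by (elim exceptional_set_exists[OF ctx, of p \<Lambda> x0]) (use \<Lambda> in auto)
    obtain c where c: "c > 0" "\<And>(x0 :: 'a) r. 0 < r \<Longrightarrow>
       ennreal (c * r powr (?n - p)) \<le> cap_compact p (sphere x0 r) (ball x0 (2 * r))"
      using cap_compact_sphere_lower_bound[OF p(1)] by metis
    have "p_thin p E x0"
    proof -
      have ratio: "cap p (E \<inter> shell i x0) (interior (wide_shell i x0)) /
          cap_compact p (sphere x0 (2 powi - int i)) (ball x0 (2 powi (- int i + 1))) \<le> ennreal (s i / c)"
        if i: "0 < i" for i
      proof -
        let ?r = "(1 / 2 :: real) ^ i"
        have pw: "\<Lambda> i powr (p - 1) = 1 / ?r powr (?n - p)"
          unfolding \<Lambda>_def powr_powr mult_minus_left \<alpha>(2) by (rule powr_minus_divide)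
        have "cap p (E \<inter> shell i x0) (interior (wide_shell i x0)) /
            cap_compact p (sphere x0 ?r) (ball x0 (2 * ?r))
          \<le> ennreal (s i * ?r powr (?n - p)) / ennreal (c * ?r powr (?n - p))"
          unfolding divide_ennreal_def
          using cap_E[OF i] c(2)[of ?r x0] unfolding pw
          by (intro mult_mono inverse_le_inverse_ennreal) (use c(1) in auto)
        also have "\<dots> = ennreal (s i / c)"
          using c(1) s(2)[of i] by (subst divide_ennreal) auto
        finally show ?thesis unfolding powi_half powi_half_shifts .
      qed
      have "(\<Sum>j. let i = Suc j in cap p (E \<inter> shell i x0) (interior (wide_shell i x0)) /
          cap_compact p (sphere x0 (2 powi - int i)) (ball x0 (2 powi (- int i + 1))))
          \<le> (\<Sum>j. ennreal (s (Suc j) / c))"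
        unfolding Let_def by (intro suminf_le ratio summableI) auto
      also have "\<dots> < \<infinity>"
      proof -
        have "summable (\<lambda>j. s (Suc j) / c)" using s(1) by (intro summable_divide) (simp add: summable_Suc_iff)
        then have "(\<Sum>j. ennreal (s (Suc j) / c)) = ennreal (\<Sum>j. s (Suc j) / c)"
          using s(2) c(1) by (intro suminf_ennreal2) auto
        then show ?thesis by simp
      qed
      finally show ?thesis unfolding p_thin_def .
    qed
    moreover have "((\<lambda>x. ennreal (norm (x - x0) powr \<alpha>) * wolff_potential \<mu> p x r0)
        \<longlongrightarrow> ennreal (1 / \<alpha> * measure \<mu> {x0} powr (1 / (p - 1)))) (at x0 within - E)"
    proof (rule weighted_wolff_potential_limit[OF ctx, where w = "\<lambda>\<rho>. ennreal (\<rho> powr \<alpha>)" and p = p, folded \<alpha>_def])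
      show "((\<lambda>\<rho>. ennreal (\<rho> powr \<alpha>)) \<longlongrightarrow> 0) (at_right 0)"
      proof -
        have "\<forall>\<^sub>F \<rho> in at_right 0. 0 \<le> (\<rho>::real)"
          using eventually_at_right_less[of 0] by eventually_elim simp
        then have "((\<lambda>\<rho>::real. \<rho> powr \<alpha>) \<longlongrightarrow> 0 powr \<alpha>) (at_right 0)"
          using \<alpha>(1) by (intro tendsto_powr') auto
        from tendsto_ennrealI[OF this] show ?thesis using \<alpha>(1) by simp
      qed
      show "((\<lambda>\<rho>. ennreal (\<rho> powr \<alpha>) * (\<integral>\<^sup>+t\<in>{\<rho><..<\<delta>}. ennreal (t powr (- \<alpha> - 1)) \<partial>lborel)) \<longlongrightarrow> ennreal (1 / \<alpha>)) (at_right 0)"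
        if "0 < \<delta>" for \<delta> by (rule power_weight_kernel_limit[OF \<alpha>(1) that])
      show "\<forall>\<^sub>F \<rho> in at_right 0. ennreal (\<rho> powr \<alpha>) * ennreal (\<rho> powr (- \<alpha>)) \<le> 1"
        using eventually_at_right_less[of 0]
        by eventually_elim (simp add: powr_minus flip: ennreal_mult)
      show "((\<lambda>x. ennreal (norm (x - x0) powr \<alpha>) * wolff_potential \<mu> p x (norm (x - x0) / 16)) \<longlongrightarrow> 0) (at x0 within - E)"
      proof (rule local)
        fix i :: nat and \<rho> :: real assume \<rho>: "0 < \<rho>" "\<rho> \<le> (1 / 2) ^ i"
        have "\<rho> powr \<alpha> * \<Lambda> i \<le> ((1 / 2) ^ i) powr \<alpha> * \<Lambda> i"
          using \<rho> \<alpha>(1) \<Lambda>[of i] by (intro mult_right_mono powr_mono2) auto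
        also have "\<dots> = 1" by (simp add: \<Lambda>_def powr_minus)
        finally show "ennreal (\<rho> powr \<alpha>) * ennreal (\<Lambda> i) \<le> ennreal 1"
          using \<Lambda>[of i] by (subst ennreal_mult[symmetric]) (auto intro!: ennreal_leI)
      qed
    qed (use assms(6,7) p \<alpha>(1) in auto)
    ultimately show ?thesis unfolding \<alpha>(3) unfolding \<alpha>_def by blast
  qed
  moreover have "\<exists>E. n_thin E x0 \<and>
      ((\<lambda>x. wolff_potential \<mu> ?n x r0 / ennreal (ln (1 / norm (x - x0))))
        \<longlongrightarrow> ennreal (measure \<mu> {x0} powr (1 / (?n - 1)))) (at x0 within - E)"
  proof -
    have n: "1 < ?n" using assms(1) by simp
    obtain E s where s: "summable s" "\<And>i. 0 \<le> s i"
      and cap_E: "\<And>i. 0 < i \<Longrightarrow> cap ?n (E \<inter> shell i x0) (interior (wide_shell i x0)) \<le> ennreal (s i / real i powr (?n - 1))"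
      and local: "\<And>(w :: real \<Rightarrow> ennreal) B.
        (\<And>i \<rho>. 0 < i \<Longrightarrow> 0 < \<rho> \<Longrightarrow> \<rho> \<le> (1 / 2) ^ i \<Longrightarrow> w \<rho> * ennreal (real i) \<le> ennreal B) \<Longrightarrow>
        ((\<lambda>x. w (norm (x - x0)) * wolff_potential \<mu> ?n x (norm (x - x0) / 16)) \<longlongrightarrow> 0) (at x0 within - E)"
      using n by (elim exceptional_set_exists[OF ctx, of ?n real x0]) auto
    have "n_thin E x0"
    proof -
      have term_le: "of_nat (i ^ (DIM('a) - 1)) * cap ?n (E \<inter> shell i x0) (interior (wide_shell i x0)) \<le> ennreal (s i)"
        if i: "0 < i" for i
      proof -
        have pw: "real i powr (?n - 1) = real (i ^ (DIM('a) - 1))"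
          using i assms(1) by (simp add: powr_realpow[symmetric] of_nat_diff)
        have "of_nat (i ^ (DIM('a) - 1)) * cap ?n (E \<inter> shell i x0) (interior (wide_shell i x0))
          \<le> ennreal (real (i ^ (DIM('a) - 1))) * ennreal (s i / real (i ^ (DIM('a) - 1)))"
          using cap_E[OF i] unfolding pw ennreal_of_nat_eq_real_of_nat by (intro mult_left_mono) auto
        also have "\<dots> = ennreal (s i)"
          using i s(2)[of i] by (subst ennreal_mult[symmetric]) auto
        finally show ?thesis .
      qed
      have "(\<Sum>j. let i = Suc j in of_nat (i ^ (DIM('a) - 1)) * cap ?n (E \<inter> shell i x0) (interior (wide_shell i x0)))
          \<le> (\<Sum>j. ennreal (s (Suc j)))"
        unfolding Let_def by (intro suminf_le term_le summableI) auto
      also have "\<dots> < \<infinity>"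
      proof -
        have "(\<Sum>j. ennreal (s (Suc j))) = ennreal (\<Sum>j. s (Suc j))"
          using s by (intro suminf_ennreal2) (auto simp: summable_Suc_iff)
        then show ?thesis by simp
      qed
      finally show ?thesis unfolding n_thin_def .
    qed
    moreover have "((\<lambda>x. inverse (ennreal (ln (1 / norm (x - x0)))) * wolff_potential \<mu> ?n x r0)
        \<longlongrightarrow> ennreal (1 * measure \<mu> {x0} powr (1 / (?n - 1)))) (at x0 within - E)"
    proof (rule weighted_wolff_potential_limit[OF ctx, where w = "\<lambda>\<rho>. inverse (ennreal (ln (1 / \<rho>)))"])
      have zero: "(?n - ?n) / (?n - 1) = 0" by simp
      have inv: "inverse (ennreal (ln (1 / \<rho>))) = ennreal (1 / ln (1 / \<rho>))" if "0 < \<rho>" "\<rho> < 1" for \<rho> :: real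
        using that by (subst inverse_ennreal) (auto simp: inverse_eq_divide)
      have "filterlim (\<lambda>\<rho>::real. inverse \<rho>) at_top (at_right 0)" by (rule filterlim_inverse_at_top_right)
      then have "filterlim (\<lambda>\<rho>::real. ln (inverse \<rho>)) at_top (at_right 0)"
        by (rule filterlim_compose[OF ln_at_top])
      then have ln_lim: "filterlim (\<lambda>\<rho>::real. ln (1 / \<rho>)) at_top (at_right 0)"
        by (simp add: inverse_eq_divide)
      show "((\<lambda>\<rho>. inverse (ennreal (ln (1 / \<rho>)))) \<longlongrightarrow> 0) (at_right 0)"
      proof -
        have "((\<lambda>\<rho>::real. 1 / ln (1 / \<rho>)) \<longlongrightarrow> 0) (at_right 0)"
          by (intro tendsto_divide_0[OF tendsto_const] filterlim_at_top_imp_at_infinity ln_lim)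
        then have "((\<lambda>\<rho>::real. ennreal (1 / ln (1 / \<rho>))) \<longlongrightarrow> ennreal 0) (at_right 0)"
          by (rule tendsto_ennrealI)
        moreover have "\<forall>\<^sub>F \<rho> in at_right 0. ennreal (1 / ln (1 / \<rho>)) = inverse (ennreal (ln (1 / \<rho>)))"
          using eventually_at_right_real[OF zero_less_one] by eventually_elim (simp add: inv)
        ultimately show ?thesis by (auto elim: Lim_transform_eventually)
      qed
      show "((\<lambda>\<rho>. inverse (ennreal (ln (1 / \<rho>))) * (\<integral>\<^sup>+t\<in>{\<rho><..<\<delta>}. ennreal (t powr (- ((?n - ?n) / (?n - 1)) - 1)) \<partial>lborel)) \<longlongrightarrow> ennreal 1) (at_right 0)"
        if "0 < \<delta>" for \<delta> unfolding zero by (rule log_weight_kernel_limit[OF that])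
      have "\<forall>\<^sub>F \<rho> in at_right 0. 1 \<le> ln (1 / \<rho> :: real)"
        using ln_lim by (simp add: filterlim_at_top)
      then show "\<forall>\<^sub>F \<rho> in at_right 0. inverse (ennreal (ln (1 / \<rho>))) * ennreal (\<rho> powr (- ((?n - ?n) / (?n - 1)))) \<le> 1"
        using eventually_at_right_real[OF zero_less_one]
      proof eventually_elim
        case (elim \<rho>)
        then have "1 / ln (1 / \<rho>) \<le> 1" by (simp only: divide_le_eq_1_pos)
        then show ?case using elim by (simp add: inv ennreal_le_1)
      qed
      show "((\<lambda>x. inverse (ennreal (ln (1 / norm (x - x0)))) * wolff_potential \<mu> ?n x (norm (x - x0) / 16)) \<longlongrightarrow> 0) (at x0 within - E)"
      proof (rule local)
        fix i :: nat and \<rho> :: real assume i: "0 < i" and \<rho>: "0 < \<rho>" "\<rho> \<le> (1 / 2) ^ i"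
        have "ln \<rho> \<le> ln ((1 / 2) ^ i)" using \<rho> by simp
        also have "\<dots> = - (i * ln 2)" by (simp add: ln_realpow ln_div)
        finally have ln_ge: "i * ln 2 \<le> ln (1 / \<rho>)" using \<rho> by (simp add: ln_div)
        have pos: "0 < i * ln (2::real)" using i by simp
        have "1 / ln (1 / \<rho>) * i \<le> 1 / (i * ln 2) * i"
          using ln_ge pos by (intro mult_right_mono frac_le) auto
        also have "\<dots> = 1 / ln 2" using i by simp
        finally have le: "1 / ln (1 / \<rho>) * i \<le> 1 / ln 2" .
        have "inverse (ennreal (ln (1 / \<rho>))) = ennreal (1 / ln (1 / \<rho>))"
          using ln_ge pos by (subst inverse_ennreal) (auto simp: inverse_eq_divide)
        then have "inverse (ennreal (ln (1 / \<rho>))) * ennreal (real i) = ennreal (1 / ln (1 / \<rho>) * i)"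
          using ln_ge pos by (simp only:) (subst ennreal_mult, auto)
        then show "inverse (ennreal (ln (1 / \<rho>))) * ennreal (real i) \<le> ennreal (1 / ln 2)"
          using le by (simp add: ennreal_leI)
      qed
    qed (use assms(6,7) n in auto)
    ultimately show ?thesis by (auto simp: divide_ennreal_def mult.commute)
  qed
  ultimately show ?thesis by blast
qed

end
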